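(* Let $(c_n)\in\ell^2_{\mathbb{R}}$ and let $H_{(c_n)}:\mathbb{CP}^\infty\to\mathbb{R}$, $H_{(c_n)}([z_n])=\langle(c_n),(|z_n|^2)\rangle_{\ell^2}=\sum_nc_n|z_n|^2$. The Hamiltonian system $(\mathbb{CP}^\infty,\Omega^{\mathrm{FS}},H_{(c_n)})$ admits infinitely many linearly independent Poisson-commuting first integrals. More precisely, for each $n\in\mathbb{N}$, the Hamiltonian $$H_n:\mathbb{CP}^\infty\to\mathbb{R},\qquad[z_m]\mapsto c_n|z_n|^2$$ is a first integral of $H_{(c_n)}$, and for all $k\ne n$ one has $$\{H_k,H_n\}_{\mathbb{CP}^\infty}=0\qquad\text{and}\qquad\{H_{(c_n)},H_n\}_{\mathbb{CP}^\infty}=0.$$ Moreover, let $(x_n)(t)$ be a gradient flow line of the restriction to $\mathcal{U}$ of the gradient flow of $H_{(c_n)}$ on $(\mathbb{CP}^\infty,\mathcal{G}^{\mathrm{FS}})$. If, in addition, $(c_n)$ is strictly monotonically decreasing, then the limit $$p_{\max}:=\lim_{t\to\infty}\Phi^{-1}\big((x_n)(t)\big)$$ exists and solves the linear programming problem $\max_{(p_n)\in\bar\Delta}\langle(c_n),(p_n)\rangle_{\ell^2}$.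
   Context: $\ell^2_{\mathbb{C}}$ (resp. $\ell^2_{\mathbb{R}}$) is the Hilbert space of square-summable complex (resp. real) sequences indexed by $\mathbb{N}$ (indices start at $0$), and $\mathbb{S}(\cdot)$ denotes its unit sphere. $\mathbb{CP}^\infty:=\mathbb{S}(\ell^2_{\mathbb{C}})/\mathbb{S}^1$, where $\mathbb{S}^1$ acts by $e^{\mathrm{i}t}\cdot(z_n)=(e^{\mathrm{i}t}z_n)$; points are written $[z_n]$ with $(z_n)\in\mathbb{S}(\ell^2_{\mathbb{C}})$. It is a Kähler manifold obtained by Kähler reduction of $\ell^2_{\mathbb{C}}$ by $\mathbb{S}^1$, with Fubini--Study metric $\mathcal{G}^{\mathrm{FS}}$ and Fubini--Study form $\Omega^{\mathrm{FS}}$ (a strong symplectic form); the canonical symplectic form on $\ell^2_{\mathbb{C}}$ is $\frac{\mathrm{i}}{2}\sum_jdz_j\wedge d\bar z_j$. The Hamiltonian vector field of $H$ is defined by $\Omega^{\mathrm{FS}}(X_H,\cdot)=dH$, and $\{\cdot,\cdot\}_{\mathbb{CP}^\infty}$ is the Poisson bracket induced by $\Omega^{\mathrm{FS}}$. A first integral of $H$ is a function constant along the flow of $X_H$. $\mathcal{U}:=\{(x_n)\in\mathbb{S}(\ell^2_{\mathbb{R}}):x_n>0\ \forall n\}\subseteq\mathbb{S}(\ell^2_{\mathbb{C}})$, identified with its image in $\mathbb{CP}^\infty$ under the quotient map. $\Delta:=\{(p_n)\in\ell^1_{\mathbb{R}}:\sum_np_n=1,\ p_n>0\ \forall n\}$,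 and $\Phi:\Delta\to\mathcal{U}$ is the square-root map $(p_n)\mapsto(\sqrt{p_n})$, so $\Phi^{-1}((x_n))=(x_n^2)$. $\bar\Delta:=\{(p_n)\in\ell^1_{\mathbb{R}}:\sum_np_n=1,\ p_n\ge0\ \forall n\}$ is the closure of $\Delta$, corresponding to the closure of $\mathcal{U}$ in $\mathbb{S}(\ell^2_{\mathbb{R}})$ under the extension of the square-root map to a homeomorphism; the limit is taken in this topology. *)

theory Defs
  imports "HOL-Analysis.Analysis"
begin

section \<open>The sequence spaces\<close>

text \<open>Both \<^typ>\<open>real\<close> and \<^typ>\<open>complex\<close> are real inner product spaces, the inner product of
  \<^typ>\<open>complex\<close> being \<open>Re (cnj z * w)\<close>; so one construction yields the real and the complex
  Hilbert space, the latter with the real part of its hermitian product.\<close>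

typedef (overloaded) 'a l2 = "{x :: nat \<Rightarrow> 'a::real_inner. summable (\<lambda>n. (norm (x n))\<^sup>2)}"
  morphisms l2_nth Abs_l2
  by (rule exI[of _ "\<lambda>_. 0"]) simp

setup_lifting type_definition_l2

lemma l2_nth_summable: "summable (\<lambda>n. (norm (l2_nth x n))\<^sup>2)"
  using l2_nth[of x] by simp

lemma l2_eqI: "(\<And>n. l2_nth x n = l2_nth y n) \<Longrightarrow> x = y"
  by (metis ext l2_nth_inject)

lemma l2_summable_add:
  fixes x y :: "nat \<Rightarrow> 'a::real_inner"
  assumes "summable (\<lambda>n. (norm (x n))\<^sup>2)" "summable (\<lambda>n. (norm (y n))\<^sup>2)"
  shows "summable (\<lambda>n. (norm (x n + y n))\<^sup>2)"
proof (rule summable_comparison_test')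
  show "summable (\<lambda>n. 2 * (norm (x n))\<^sup>2 + 2 * (norm (y n))\<^sup>2)"
    using assms by (intro summable_add summable_mult)
  fix n
  have "(norm (x n + y n))\<^sup>2 \<le> (norm (x n) + norm (y n))\<^sup>2"
    by (intro power_mono norm_triangle_ineq) simp
  also have "\<dots> \<le> 2 * (norm (x n))\<^sup>2 + 2 * (norm (y n))\<^sup>2"
    using sum_squares_bound[of "norm (x n)" "norm (y n)"] by (simp add: power2_sum)
  finally show "norm ((norm (x n + y n))\<^sup>2) \<le> 2 * (norm (x n))\<^sup>2 + 2 * (norm (y n))\<^sup>2"
    by simp
qed

lemma l2_summable_scaleR:
  fixes x :: "nat \<Rightarrow> 'a::real_inner"
  assumes "summable (\<lambda>n. (norm (x n))\<^sup>2)"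
  shows "summable (\<lambda>n. (norm (a *\<^sub>R x n))\<^sup>2)"
  using summable_mult[OF assms, of "a\<^sup>2"] by (simp add: power_mult_distrib)

lemma l2_summable_inner:
  fixes x y :: "nat \<Rightarrow> 'a::real_inner"
  assumes "summable (\<lambda>n. (norm (x n))\<^sup>2)" "summable (\<lambda>n. (norm (y n))\<^sup>2)"
  shows "summable (\<lambda>n. inner (x n) (y n))"
proof (rule summable_comparison_test')
  show "summable (\<lambda>n. (norm (x n))\<^sup>2 + (norm (y n))\<^sup>2)"
    using assms by (intro summable_add)
  fix n
  have "\<bar>inner (x n) (y n)\<bar> \<le> norm (x n) * norm (y n)"
    by (rule Cauchy_Schwarz_ineq2)
  also have "\<dots> \<le> 2 * norm (x n) * norm (y n)"
    by simp
  also have "\<dots> \<le> (norm (x n))\<^sup>2 + (norm (y n))\<^sup>2"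
    by (rule sum_squares_bound)
  finally show "norm (inner (x n) (y n)) \<le> (norm (x n))\<^sup>2 + (norm (y n))\<^sup>2"
    by simp
qed

instantiation l2 :: (real_inner) real_inner
begin

lift_definition zero_l2 :: "'a l2" is "\<lambda>_. 0" by simp
lift_definition plus_l2 :: "'a l2 \<Rightarrow> 'a l2 \<Rightarrow> 'a l2" is "\<lambda>x y n. x n + y n"
  by (simp add: l2_summable_add)
lift_definition uminus_l2 :: "'a l2 \<Rightarrow> 'a l2" is "\<lambda>x n. - x n" by simp
lift_definition scaleR_l2 :: "real \<Rightarrow> 'a l2 \<Rightarrow> 'a l2" is "\<lambda>a x n. a *\<^sub>R x n"
  using l2_summable_scaleR by blast
lift_definition minus_l2 :: "'a l2 \<Rightarrow> 'a l2 \<Rightarrow> 'a l2" is "\<lambda>x y n. x n - y n"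
  using l2_summable_add[where y = "\<lambda>n. - y n" for y] by simp
lift_definition inner_l2 :: "'a l2 \<Rightarrow> 'a l2 \<Rightarrow> real" is "\<lambda>x y. \<Sum>n. inner (x n) (y n)" .

definition norm_l2 :: "'a l2 \<Rightarrow> real" where "norm_l2 x = sqrt (inner x x)"
definition dist_l2 :: "'a l2 \<Rightarrow> 'a l2 \<Rightarrow> real" where "dist_l2 x y = norm (x - y)"
definition sgn_l2 :: "'a l2 \<Rightarrow> 'a l2" where "sgn_l2 x = inverse (norm x) *\<^sub>R x"
definition uniformity_l2 :: "('a l2 \<times> 'a l2) filter"
  where "uniformity_l2 = (INF e\<in>{0<..}. principal {(x, y). dist x y < e})"
definition open_l2 :: "'a l2 set \<Rightarrow> bool"
  where "open_l2 U \<longleftrightarrow> (\<forall>x\<in>U. eventually (\<lambda>(x', y). x' = x \<longrightarrow> y \<in> U) uniformity)"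

instance
proof
  fix x y z :: "'a l2" and a b :: real
  show "x + y + z = x + (y + z)" by transfer (simp add: add.assoc)
  show "x + y = y + x" by transfer (simp add: add.commute)
  show "0 + x = x" by transfer simp
  show "- x + x = 0" by transfer simp
  show "x - y = x + - y" by transfer simp
  show "a *\<^sub>R (x + y) = a *\<^sub>R x + a *\<^sub>R y" by transfer (simp add: scaleR_add_right)
  show "(a + b) *\<^sub>R x = a *\<^sub>R x + b *\<^sub>R x" by transfer (simp add: scaleR_add_left)
  show "a *\<^sub>R b *\<^sub>R x = (a * b) *\<^sub>R x" by transfer simp
  show "1 *\<^sub>R x = x" by transfer simp
  show "dist x y = norm (x - y)" by (rule dist_l2_def)
  show "sgn x = inverse (norm x) *\<^sub>R x" by (rule sgn_l2_def)
  show "uniformity = (INF e\<in>{0<..}. principal {(x :: 'a l2, y). dist x y < e})"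
    by (rule uniformity_l2_def)
  show "open U \<longleftrightarrow> (\<forall>x\<in>U. eventually (\<lambda>(x', y). x' = x \<longrightarrow> y \<in> U) uniformity)"
    for U :: "'a l2 set" by (rule open_l2_def)
  show "inner x y = inner y x" by transfer (simp add: inner_commute)
  show "inner (x + y) z = inner x z + inner y z"
    by transfer (simp add: inner_add_left suminf_add l2_summable_inner)
  show "inner (a *\<^sub>R x) y = a * inner x y"
    by transfer (simp add: suminf_mult l2_summable_inner)
  show "0 \<le> inner x x"
    by transfer (auto intro!: suminf_nonneg l2_summable_inner)
  show "(inner x x = 0) = (x = 0)"
  proof transfer
    fix x :: "nat \<Rightarrow> 'a" assume "summable (\<lambda>n. (norm (x n))\<^sup>2)"
    then have "(\<Sum>n. inner (x n) (x n)) = 0 \<longleftrightarrow> (\<forall>n. inner (x n) (x n) = 0)"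
      by (intro suminf_eq_zero_iff l2_summable_inner) auto
    then show "((\<Sum>n. inner (x n) (x n)) = 0) = (x = (\<lambda>_. 0))"
      by (auto simp: fun_eq_iff)
  qed
  show "norm x = sqrt (inner x x)" by (rule norm_l2_def)
qed

end

lemma norm_l2_eq: "(norm x)\<^sup>2 = (\<Sum>n. (norm (l2_nth x n))\<^sup>2)"
  unfolding power2_norm_eq_inner by transfer simp

typedef l1 = "{p :: nat \<Rightarrow> real. summable (\<lambda>n. \<bar>p n\<bar>)}"
  morphisms l1_nth Abs_l1
  by (rule exI[of _ "\<lambda>_. 0"]) simp

setup_lifting type_definition_l1

lemma l1_summable_add:
  fixes p q :: "nat \<Rightarrow> real"
  assumes "summable (\<lambda>n. \<bar>p n\<bar>)" "summable (\<lambda>n. \<bar>q n\<bar>)"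
  shows "summable (\<lambda>n. \<bar>p n + q n\<bar>)"
  by (rule summable_comparison_test'[OF summable_add[OF assms]]) simp

instantiation l1 :: real_normed_vector
begin

lift_definition zero_l1 :: l1 is "\<lambda>_. 0" by simp
lift_definition plus_l1 :: "l1 \<Rightarrow> l1 \<Rightarrow> l1" is "\<lambda>p q n. p n + q n"
  by (simp add: l1_summable_add)
lift_definition uminus_l1 :: "l1 \<Rightarrow> l1" is "\<lambda>p n. - p n" by simp
lift_definition scaleR_l1 :: "real \<Rightarrow> l1 \<Rightarrow> l1" is "\<lambda>a p n. a * p n"
  by (simp add: abs_mult summable_mult)
lift_definition minus_l1 :: "l1 \<Rightarrow> l1 \<Rightarrow> l1" is "\<lambda>p q n. p n - q n"
  using l1_summable_add[where q = "\<lambda>n. - q n" for q] by simp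
lift_definition norm_l1 :: "l1 \<Rightarrow> real" is "\<lambda>p. \<Sum>n. \<bar>p n\<bar>" .

definition dist_l1 :: "l1 \<Rightarrow> l1 \<Rightarrow> real" where "dist_l1 p q = norm (p - q)"
definition sgn_l1 :: "l1 \<Rightarrow> l1" where "sgn_l1 p = inverse (norm p) *\<^sub>R p"
definition uniformity_l1 :: "(l1 \<times> l1) filter"
  where "uniformity_l1 = (INF e\<in>{0<..}. principal {(p, q). dist p q < e})"
definition open_l1 :: "l1 set \<Rightarrow> bool"
  where "open_l1 U \<longleftrightarrow> (\<forall>p\<in>U. eventually (\<lambda>(p', q). p' = p \<longrightarrow> q \<in> U) uniformity)"

instance
proof
  fix p q r :: l1 and a b :: real
  show "p + q + r = p + (q + r)" by transfer (simp add: add.assoc)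
  show "p + q = q + p" by transfer (simp add: add.commute)
  show "0 + p = p" by transfer simp
  show "- p + p = 0" by transfer simp
  show "p - q = p + - q" by transfer simp
  show "a *\<^sub>R (p + q) = a *\<^sub>R p + a *\<^sub>R q" by transfer (simp add: algebra_simps)
  show "(a + b) *\<^sub>R p = a *\<^sub>R p + b *\<^sub>R p" by transfer (simp add: algebra_simps)
  show "a *\<^sub>R b *\<^sub>R p = (a * b) *\<^sub>R p" by transfer (simp add: algebra_simps)
  show "1 *\<^sub>R p = p" by transfer simp
  show "dist p q = norm (p - q)" by (rule dist_l1_def)
  show "sgn p = inverse (norm p) *\<^sub>R p" by (rule sgn_l1_def)
  show "uniformity = (INF e\<in>{0<..}. principal {(p :: l1, q). dist p q < e})"
    by (rule uniformity_l1_def)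
  show "open U \<longleftrightarrow> (\<forall>p\<in>U. eventually (\<lambda>(p', q). p' = p \<longrightarrow> q \<in> U) uniformity)"
    for U :: "l1 set" by (rule open_l1_def)
  show "(norm p = 0) = (p = 0)"
    by transfer (auto simp: suminf_eq_zero_iff fun_eq_iff)
  show "norm (p + q) \<le> norm p + norm q"
    by transfer (auto simp: suminf_add intro!: suminf_le l1_summable_add summable_add)
  show "norm (a *\<^sub>R p) = \<bar>a\<bar> * norm p"
    by transfer (simp add: abs_mult suminf_mult)
qed

end

section \<open>The symplectic form and the circle action on complex \<open>\<ell>\<^sup>2\<close>\<close>

text \<open>\<open>(\<i>/2) (dz \<and> d\<bar>z) (v, w) = (\<i>/2) (v * cnj w - w * cnj v) = Im (cnj v * w)\<close>.\<close>

definition l2_omega :: "complex l2 \<Rightarrow> complex l2 \<Rightarrow> real" where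
  "l2_omega v w = (\<Sum>j. Im (cnj (l2_nth v j) * l2_nth w j))"

lift_definition l2_cscale :: "complex \<Rightarrow> complex l2 \<Rightarrow> complex l2" is "\<lambda>a z n. a * z n"
  by (simp add: norm_mult power_mult_distrib summable_mult)

lemma l2_cscale_simps:
  "l2_cscale a (l2_cscale b z) = l2_cscale (a * b) z"
  "l2_cscale 1 z = z"
  "l2_cscale a (z + w) = l2_cscale a z + l2_cscale a w"
  "l2_cscale (a + b) z = l2_cscale a z + l2_cscale b z"
  "l2_cscale a (s *\<^sub>R z) = s *\<^sub>R l2_cscale a z"
  by (transfer, simp add: algebra_simps)+

lemma l2_omega_eq_inner: "l2_omega v w = inner (l2_cscale \<i> v) w"
  unfolding l2_omega_def by transfer (simp add: inner_complex_def algebra_simps)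

lemma inner_cscale_cis [simp]: "inner (l2_cscale (cis t) z) (l2_cscale (cis t) w) = inner z w"
proof transfer
  fix t and z w :: "nat \<Rightarrow> complex"
  have "inner (cis t * z n) (cis t * w n) = inner (z n) (w n)" for n
  proof -
    have "inner (cis t * z n) (cis t * w n) = Re ((cis t * cnj (cis t)) * (z n * cnj (w n)))"
      by (simp add: inner_complex_def algebra_simps)
    also have "cis t * cnj (cis t) = 1"
      by (simp add: cis_cnj cis_mult)
    finally show ?thesis by (simp add: inner_complex_def)
  qed
  then show "(\<Sum>n. inner (cis t * z n) (cis t * w n)) = (\<Sum>n. inner (z n) (w n))" by simp
qed

lemma inner_i_cscale: "inner (l2_cscale \<i> z) z = 0"
  by transfer (simp add: inner_complex_def mult.commute)

lemma inner_i_i [simp]: "inner (l2_cscale \<i> z) (l2_cscale \<i> w) = inner z w"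
  using inner_cscale_cis[of "pi / 2" z w] by simp

lemma norm_cscale_cis [simp]: "norm (l2_cscale (cis t) z) = norm z"
  by (simp add: norm_eq_sqrt_inner)

lemma l2_cscale_eq: "l2_cscale a z = Re a *\<^sub>R z + Im a *\<^sub>R l2_cscale \<i> z"
proof (rule l2_eqI)
  fix n
  have "a * l2_nth z n = (complex_of_real (Re a) + \<i> * complex_of_real (Im a)) * l2_nth z n"
    by (simp flip: complex_eq)
  then show "l2_nth (l2_cscale a z) n = l2_nth (Re a *\<^sub>R z + Im a *\<^sub>R l2_cscale \<i> z) n"
    by (simp add: l2_cscale.rep_eq plus_l2.rep_eq scaleR_l2.rep_eq scaleR_conv_of_real algebra_simps)
qed

lemma norm_l2_cscale: "norm (l2_cscale a z) = cmod a * norm z"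
proof -
  have "inner (l2_cscale a z) (l2_cscale a z) = ((Re a)\<^sup>2 + (Im a)\<^sup>2) * inner z z"
    by (subst (1 2) l2_cscale_eq)
      (simp add: inner_add_left inner_add_right inner_i_cscale inner_commute[of z "l2_cscale \<i> z"]
        power2_eq_square algebra_simps)
  then have "(norm (l2_cscale a z))\<^sup>2 = (cmod a * norm z)\<^sup>2"
    unfolding power_mult_distrib cmod_power2 by (simp only: power2_norm_eq_inner)
  then show ?thesis by simp
qed

section \<open>Infinite-dimensional complex projective space\<close>

definition cp_rel :: "complex l2 \<Rightarrow> complex l2 \<Rightarrow> bool" where
  "cp_rel z w \<longleftrightarrow> norm z = 1 \<and> norm w = 1 \<and> (\<exists>t. w = l2_cscale (cis t) z)"

lemma ex_unit_vector: "\<exists>z :: complex l2. norm z = 1"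
proof -
  let ?f = "\<lambda>n. if n = 0 then (1 :: complex) else 0"
  have eq: "(\<lambda>n. (cmod (?f n))\<^sup>2) = (\<lambda>n. if n = 0 then 1 else 0)" by auto
  have "(\<lambda>n. (cmod (?f n))\<^sup>2) sums 1" unfolding eq using sums_single[of 0 "\<lambda>_. 1 :: real"] by simp
  then have s: "summable (\<lambda>n. (cmod (?f n))\<^sup>2)" and "(\<Sum>n. (cmod (?f n))\<^sup>2) = 1"
    by (auto simp: sums_iff)
  then have "(norm (Abs_l2 ?f))\<^sup>2 = 1"
    unfolding norm_l2_eq by (simp add: Abs_l2_inverse)
  then have "norm (Abs_l2 ?f) = 1" by (simp add: power2_eq_1_iff) (smt (verit) norm_ge_zero)
  then show ?thesis by blast
qed

quotient_type cp_inf = "complex l2" / partial: cp_rel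
  morphisms rep_cp cp_proj
proof (rule part_equivpI)
  show "\<exists>z. cp_rel z z"
  proof -
    obtain z :: "complex l2" where "norm z = 1" using ex_unit_vector by blast
    then have "cp_rel z z" by (auto simp: cp_rel_def l2_cscale_simps intro!: exI[of _ 0])
    then show ?thesis by blast
  qed
  show "symp cp_rel"
  proof (rule sympI)
    fix z w assume "cp_rel z w"
    then obtain t where t: "norm z = 1" "norm w = 1" "w = l2_cscale (cis t) z"
      by (auto simp: cp_rel_def)
    then have "z = l2_cscale (cis (- t)) w" by (simp add: l2_cscale_simps cis_mult)
    with t(1,2) show "cp_rel w z" unfolding cp_rel_def by blast
  qed
  show "transp cp_rel"
    by (rule transpI) (auto simp: cp_rel_def l2_cscale_simps cis_mult)
qed

text \<open>The tangent bundle is the tangent bundle of the sphere divided by the circle action and by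
  the directions \<open>\<i> z\<close> of its orbits: \<open>(z, v)\<close> represents the image of \<open>v\<close> under the differential
  of the quotient map at \<open>z\<close>.\<close>

definition sphere_tangent :: "complex l2 \<Rightarrow> complex l2 \<Rightarrow> bool" where
  "sphere_tangent z v \<longleftrightarrow> norm z = 1 \<and> inner z v = 0"

definition cp_tangent_rel :: "complex l2 \<times> complex l2 \<Rightarrow> complex l2 \<times> complex l2 \<Rightarrow> bool" where
  "cp_tangent_rel = (\<lambda>(z, v) (w, u). sphere_tangent z v \<and> sphere_tangent w u \<and>
     (\<exists>t s. w = l2_cscale (cis t) z \<and> u = l2_cscale (cis t) v + s *\<^sub>R l2_cscale \<i> w))"

quotient_type cp_tangent = "complex l2 \<times> complex l2" / partial: cp_tangent_rel
proof (rule part_equivpI)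
  obtain z :: "complex l2" where "norm z = 1" using ex_unit_vector by blast
  then have "cp_tangent_rel (z, 0) (z, 0)"
    by (auto simp: cp_tangent_rel_def sphere_tangent_def l2_cscale_simps intro!: exI[of _ 0])
  then show "\<exists>x. cp_tangent_rel x x" by blast
  show "symp cp_tangent_rel"
  proof (rule sympI, clarify)
    fix z v w u assume "cp_tangent_rel (z, v) (w, u)"
    then obtain t s where t: "sphere_tangent z v" "sphere_tangent w u"
      "w = l2_cscale (cis t) z" "u = l2_cscale (cis t) v + s *\<^sub>R l2_cscale \<i> w"
      by (auto simp: cp_tangent_rel_def)
    have "z = l2_cscale (cis (- t)) w"
      by (simp add: t(3) l2_cscale_simps cis_mult)
    moreover have "v = l2_cscale (cis (- t)) u + (- s) *\<^sub>R l2_cscale \<i> z"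
      by (simp add: t(3,4) l2_cscale_simps cis_mult mult.left_commute[of "cis (- t)" \<i>])
    ultimately show "cp_tangent_rel (w, u) (z, v)"
      using t(1,2) unfolding cp_tangent_rel_def by blast
  qed
  show "transp cp_tangent_rel"
  proof (rule transpI, clarify)
    fix z v w u y x
    assume "cp_tangent_rel (z, v) (w, u)" "cp_tangent_rel (w, u) (y, x)"
    then obtain t s t' s' where t: "sphere_tangent z v" "sphere_tangent y x"
      "w = l2_cscale (cis t) z" "u = l2_cscale (cis t) v + s *\<^sub>R l2_cscale \<i> w"
      "y = l2_cscale (cis t') w" "x = l2_cscale (cis t') u + s' *\<^sub>R l2_cscale \<i> y"
      by (auto simp: cp_tangent_rel_def)
    have "y = l2_cscale (cis (t' + t)) z"
      by (simp add: t(3,5) l2_cscale_simps cis_mult)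
    moreover have "x = l2_cscale (cis (t' + t)) v + (s + s') *\<^sub>R l2_cscale \<i> y"
      by (simp add: t(4,5,6) l2_cscale_simps cis_mult mult.commute scaleR_add_left)
    ultimately show "cp_tangent_rel (z, v) (y, x)"
      using t(1,2) unfolding cp_tangent_rel_def by blast
  qed
qed

definition cp_dproj :: "complex l2 \<Rightarrow> complex l2 \<Rightarrow> cp_tangent" where
  "cp_dproj z v = abs_cp_tangent (z, v)"

lift_definition cp_base :: "cp_tangent \<Rightarrow> cp_inf" is fst
  by (auto simp: cp_tangent_rel_def cp_rel_def sphere_tangent_def)

definition cp_tangent_space :: "cp_inf \<Rightarrow> cp_tangent set" where
  "cp_tangent_space p = {X. cp_base X = p}"

section \<open>The Fubini--Study structure\<close>

text \<open>The reduced form is the form whose pull-back to the sphere is the restriction of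
  \<^const>\<open>l2_omega\<close>; the metric makes the quotient map a Riemannian submersion. Both are meant for
  tangent vectors with a common base point.\<close>

definition fs_form :: "cp_tangent \<Rightarrow> cp_tangent \<Rightarrow> real" where
  "fs_form X Y = (THE a. \<exists>z v w. sphere_tangent z v \<and> sphere_tangent z w \<and>
     X = cp_dproj z v \<and> Y = cp_dproj z w \<and> a = l2_omega v w)"

definition horizontal_part :: "complex l2 \<Rightarrow> complex l2 \<Rightarrow> complex l2" where
  "horizontal_part z v = v - inner (l2_cscale \<i> z) v *\<^sub>R l2_cscale \<i> z"

definition fs_metric :: "cp_tangent \<Rightarrow> cp_tangent \<Rightarrow> real" where
  "fs_metric X Y = (THE a. \<exists>z v w. sphere_tangent z v \<and> sphere_tangent z w \<and>
     X = cp_dproj z v \<and> Y = cp_dproj z w \<and>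
     a = inner (horizontal_part z v) (horizontal_part z w))"

lemma cp_dproj_eq_iff:
  assumes "sphere_tangent z v" "sphere_tangent w u"
  shows "cp_dproj z v = cp_dproj w u \<longleftrightarrow>
    (\<exists>t s. w = l2_cscale (cis t) z \<and> u = l2_cscale (cis t) v + s *\<^sub>R l2_cscale \<i> w)"
proof -
  have refl: "cp_tangent_rel (z, v) (z, v)" if "sphere_tangent z v" for z v
    using that by (auto simp: cp_tangent_rel_def l2_cscale_simps intro!: exI[of _ 0])
  have "cp_dproj z v = cp_dproj w u \<longleftrightarrow> cp_tangent_rel (z, v) (w, u)"
    unfolding cp_dproj_def using Quotient3_rel[OF Quotient3_cp_tangent] refl assms by blast
  with assms show ?thesis by (auto simp: cp_tangent_rel_def)
qed

lemma cp_dproj_common_base: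
  assumes "sphere_tangent z v" "sphere_tangent z w" "sphere_tangent y v'" "sphere_tangent y w'"
    and "cp_dproj z v = cp_dproj y v'" "cp_dproj z w = cp_dproj y w'"
  obtains t a b where "y = l2_cscale (cis t) z"
    "v' = l2_cscale (cis t) (v + a *\<^sub>R l2_cscale \<i> z)"
    "w' = l2_cscale (cis t) (w + b *\<^sub>R l2_cscale \<i> z)"
proof -
  obtain t a where 1: "y = l2_cscale (cis t) z" "v' = l2_cscale (cis t) v + a *\<^sub>R l2_cscale \<i> y"
    using assms cp_dproj_eq_iff by metis
  obtain t' b where 2: "y = l2_cscale (cis t') z" "w' = l2_cscale (cis t') w + b *\<^sub>R l2_cscale \<i> y"
    using assms cp_dproj_eq_iff by metis
  have "l2_cscale (cis t - cis t') z = l2_cscale (cis t) z - l2_cscale (cis t') z"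
    by transfer (simp add: algebra_simps)
  also have "\<dots> = 0" using 1(1) 2(1) by simp
  finally have "cmod (cis t - cis t') * norm z = 0"
    by (metis norm_l2_cscale norm_zero)
  then have "cis t' = cis t" using assms(1) by (auto simp: sphere_tangent_def)
  then show thesis
    using 1 2 by (intro that[of t a b]) (simp_all add: l2_cscale_simps mult.commute)
qed

lemma fs_form_eq:
  assumes "sphere_tangent z v" "sphere_tangent z w"
  shows "fs_form (cp_dproj z v) (cp_dproj z w) = l2_omega v w"
  unfolding fs_form_def
proof (rule the_equality)
  show "\<exists>z' v' w'. sphere_tangent z' v' \<and> sphere_tangent z' w' \<and>
      cp_dproj z v = cp_dproj z' v' \<and> cp_dproj z w = cp_dproj z' w' \<and> l2_omega v w = l2_omega v' w'"
    using assms by blast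
next
  fix a assume "\<exists>z' v' w'. sphere_tangent z' v' \<and> sphere_tangent z' w' \<and>
      cp_dproj z v = cp_dproj z' v' \<and> cp_dproj z w = cp_dproj z' w' \<and> a = l2_omega v' w'"
  then obtain y v' w' where y: "sphere_tangent y v'" "sphere_tangent y w'"
    "cp_dproj z v = cp_dproj y v'" "cp_dproj z w = cp_dproj y w'" "a = l2_omega v' w'"
    by blast
  obtain t r s where eq: "v' = l2_cscale (cis t) (v + r *\<^sub>R l2_cscale \<i> z)"
    "w' = l2_cscale (cis t) (w + s *\<^sub>R l2_cscale \<i> z)"
    using cp_dproj_common_base[OF assms y(1-4)] by metis
  have "a = inner (l2_cscale (cis t) (l2_cscale \<i> (v + r *\<^sub>R l2_cscale \<i> z)))
      (l2_cscale (cis t) (w + s *\<^sub>R l2_cscale \<i> z))"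
    unfolding y(5) l2_omega_eq_inner eq by (simp add: l2_cscale_simps(1) mult.commute)
  also have "\<dots> = inner (l2_cscale \<i> (v + r *\<^sub>R l2_cscale \<i> z)) (w + s *\<^sub>R l2_cscale \<i> z)"
    by (rule inner_cscale_cis)
  also have "l2_cscale \<i> (v + r *\<^sub>R l2_cscale \<i> z) = l2_cscale \<i> v - r *\<^sub>R z"
    by transfer (auto simp: fun_eq_iff algebra_simps)
  also have "inner \<dots> (w + s *\<^sub>R l2_cscale \<i> z) = inner (l2_cscale \<i> v) w"
    using assms inner_i_i[of v z] inner_i_cscale[of z] inner_commute[of z v]
      inner_commute[of z "l2_cscale \<i> z"]
    by (simp add: inner_diff_left inner_add_right sphere_tangent_def)
  finally show "a = l2_omega v w" by (simp add: l2_omega_eq_inner)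
qed

lemma fs_metric_eq:
  assumes "sphere_tangent z v" "sphere_tangent z w"
  shows "fs_metric (cp_dproj z v) (cp_dproj z w) =
    inner (horizontal_part z v) (horizontal_part z w)"
  unfolding fs_metric_def
proof (rule the_equality)
  show "\<exists>z' v' w'. sphere_tangent z' v' \<and> sphere_tangent z' w' \<and>
      cp_dproj z v = cp_dproj z' v' \<and> cp_dproj z w = cp_dproj z' w' \<and>
      inner (horizontal_part z v) (horizontal_part z w) =
      inner (horizontal_part z' v') (horizontal_part z' w')"
    using assms by blast
next
  fix a assume "\<exists>z' v' w'. sphere_tangent z' v' \<and> sphere_tangent z' w' \<and>
      cp_dproj z v = cp_dproj z' v' \<and> cp_dproj z w = cp_dproj z' w' \<and>
      a = inner (horizontal_part z' v') (horizontal_part z' w')"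
  then obtain y v' w' where y: "sphere_tangent y v'" "sphere_tangent y w'"
    "cp_dproj z v = cp_dproj y v'" "cp_dproj z w = cp_dproj y w'"
    "a = inner (horizontal_part y v') (horizontal_part y w')"
    by blast
  obtain t r s where eq: "y = l2_cscale (cis t) z"
    "v' = l2_cscale (cis t) (v + r *\<^sub>R l2_cscale \<i> z)"
    "w' = l2_cscale (cis t) (w + s *\<^sub>R l2_cscale \<i> z)"
    using cp_dproj_common_base[OF assms y(1-4)] by metis
  have z: "inner z z = 1" using assms(1) by (simp add: sphere_tangent_def norm_eq_1)
  have hor: "horizontal_part (l2_cscale (cis t) z) (l2_cscale (cis t) (x + q *\<^sub>R l2_cscale \<i> z)) =
      l2_cscale (cis t) (horizontal_part z x)" for x q
  proof -
    have i: "l2_cscale \<i> (l2_cscale (cis t) z) = l2_cscale (cis t) (l2_cscale \<i> z)"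
      by (simp add: l2_cscale_simps mult.commute)
    have d: "l2_cscale (cis t) (x - q *\<^sub>R y) = l2_cscale (cis t) x - q *\<^sub>R l2_cscale (cis t) y" for x y q
      by transfer (auto simp: fun_eq_iff algebra_simps)
    show ?thesis
      unfolding horizontal_part_def i inner_cscale_cis d
      by (simp add: inner_add_right z l2_cscale_simps scaleR_add_left)
  qed
  show "a = inner (horizontal_part z v) (horizontal_part z w)"
    unfolding y(5) eq hor by simp
qed

section \<open>Calculus on the projective space\<close>

text \<open>On a Banach space, asking for all iterated directional derivatives to be Frechet
  differentiable amounts to \<open>C\<^sup>\<infinity>\<close> in the sense of operator norms, by uniform boundedness.\<close>

primrec higher_differentiable_on ::
    "nat \<Rightarrow> 'a::real_normed_vector set \<Rightarrow> ('a \<Rightarrow> 'b::real_normed_vector) \<Rightarrow> bool" where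
  "higher_differentiable_on 0 S f \<longleftrightarrow> continuous_on S f"
| "higher_differentiable_on (Suc k) S f \<longleftrightarrow> (\<forall>x\<in>S. f differentiable (at x)) \<and>
     (\<forall>v. higher_differentiable_on k S (\<lambda>x. frechet_derivative f (at x) v))"

definition smooth_on :: "'a::real_normed_vector set \<Rightarrow> ('a \<Rightarrow> 'b::real_normed_vector) \<Rightarrow> bool" where
  "smooth_on S f \<longleftrightarrow> (\<forall>k. higher_differentiable_on k S f)"

text \<open>A function on the quotient is smooth iff its pull-back to the sphere is, that is, extends to a
  smooth function on a neighbourhood of the sphere.\<close>

definition cp_smooth :: "(cp_inf \<Rightarrow> real) \<Rightarrow> bool" where
  "cp_smooth F \<longleftrightarrow> (\<exists>W G. open W \<and> sphere 0 1 \<subseteq> W \<and> smooth_on W G \<and>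
     (\<forall>z\<in>sphere 0 1. G z = F (cp_proj z)))"

text \<open>The values on tangent vectors of a derivative \<open>D\<close> within the sphere are determined uniquely.\<close>

definition cp_differential :: "(cp_inf \<Rightarrow> real) \<Rightarrow> cp_tangent \<Rightarrow> real" where
  "cp_differential F X = (THE a. \<exists>z v D. sphere_tangent z v \<and> X = cp_dproj z v \<and>
     ((\<lambda>w. F (cp_proj w)) has_derivative D) (at z within sphere 0 1) \<and> a = D v)"

definition cp_ham_vf :: "(cp_inf \<Rightarrow> real) \<Rightarrow> cp_inf \<Rightarrow> cp_tangent" where
  "cp_ham_vf F p = (THE X. X \<in> cp_tangent_space p \<and>
     (\<forall>Y\<in>cp_tangent_space p. fs_form X Y = cp_differential F Y))"

definition cp_grad :: "(cp_inf \<Rightarrow> real) \<Rightarrow> cp_inf \<Rightarrow> cp_tangent" where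
  "cp_grad F p = (THE X. X \<in> cp_tangent_space p \<and>
     (\<forall>Y\<in>cp_tangent_space p. fs_metric X Y = cp_differential F Y))"

definition cp_poisson :: "(cp_inf \<Rightarrow> real) \<Rightarrow> (cp_inf \<Rightarrow> real) \<Rightarrow> cp_inf \<Rightarrow> real" where
  "cp_poisson F G p = fs_form (cp_ham_vf F p) (cp_ham_vf G p)"

text \<open>A curve in the quotient is differentiable iff it has local differentiable lifts to the sphere,
  whose velocities then project to its velocity. The derivative is taken within \<open>J\<close>, hence one-sided
  at an end point that belongs to \<open>J\<close>.\<close>

definition cp_has_velocity :: "(real \<Rightarrow> cp_inf) \<Rightarrow> cp_tangent \<Rightarrow> real \<Rightarrow> real set \<Rightarrow> bool" where
  "cp_has_velocity \<gamma> X t J \<longleftrightarrow> (\<exists>\<zeta> v e. e > 0 \<and>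
     (\<forall>s\<in>J \<inter> ball t e. norm (\<zeta> s) = 1 \<and> cp_proj (\<zeta> s) = \<gamma> s) \<and>
     (\<zeta> has_vector_derivative v) (at t within J) \<and> X = cp_dproj (\<zeta> t) v)"

definition cp_integral_curve :: "(cp_inf \<Rightarrow> cp_tangent) \<Rightarrow> (real \<Rightarrow> cp_inf) \<Rightarrow> real set \<Rightarrow> bool" where
  "cp_integral_curve V \<gamma> J \<longleftrightarrow> is_interval J \<and> (\<forall>t\<in>J. cp_has_velocity \<gamma> (V (\<gamma> t)) t J)"

definition cp_first_integral :: "(cp_inf \<Rightarrow> real) \<Rightarrow> (cp_inf \<Rightarrow> real) \<Rightarrow> bool" where
  "cp_first_integral H F \<longleftrightarrow>
     (\<forall>\<gamma> J. cp_integral_curve (cp_ham_vf H) \<gamma> J \<longrightarrow> (\<forall>s\<in>J. \<forall>t\<in>J. F (\<gamma> s) = F (\<gamma> t)))"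

definition lin_indep_family :: "'i set \<Rightarrow> ('i \<Rightarrow> 'p \<Rightarrow> real) \<Rightarrow> bool" where
  "lin_indep_family I F \<longleftrightarrow> (\<forall>K a. finite K \<longrightarrow> K \<subseteq> I \<longrightarrow>
     (\<forall>p. (\<Sum>i\<in>K. a i * F i p) = 0) \<longrightarrow> (\<forall>i\<in>K. a i = 0))"

lift_definition cp_H :: "real l2 \<Rightarrow> cp_inf \<Rightarrow> real"
  is "\<lambda>c z. \<Sum>n. l2_nth c n * (cmod (l2_nth z n))\<^sup>2"
  by (auto simp: cp_rel_def l2_cscale.rep_eq norm_mult)

lift_definition cp_H_comp :: "real l2 \<Rightarrow> nat \<Rightarrow> cp_inf \<Rightarrow> real"
  is "\<lambda>c n z. l2_nth c n * (cmod (l2_nth z n))\<^sup>2"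
  by (auto simp: cp_rel_def l2_cscale.rep_eq norm_mult)

section \<open>The simplex and the positive part of the real sphere\<close>

definition pos_sphere :: "real l2 set" where
  "pos_sphere = {x. norm x = 1 \<and> (\<forall>n. l2_nth x n > 0)}"

definition pos_simplex :: "l1 set" where
  "pos_simplex = {p. (\<Sum>n. l1_nth p n) = 1 \<and> (\<forall>n. l1_nth p n > 0)}"

definition closed_simplex :: "l1 set" where
  "closed_simplex = {p. (\<Sum>n. l1_nth p n) = 1 \<and> (\<forall>n. l1_nth p n \<ge> 0)}"

text \<open>Only meant on \<^const>\<open>closed_simplex\<close>; the absolute value makes the map total.\<close>

lift_definition sqrt_map :: "l1 \<Rightarrow> real l2" is "\<lambda>p n. sqrt \<bar>p n\<bar>"
  by simp

lemma bij_betw_sqrt_map: "bij_betw sqrt_map pos_simplex pos_sphere"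
proof -
  have summ: "summable (\<lambda>n. l1_nth p n)" for p
    using l1_nth[of p] summable_rabs_cancel by blast
  have sq: "(\<lambda>n. (l2_nth x n)\<^sup>2) \<in> {p. summable (\<lambda>n. \<bar>p n\<bar>)}" for x :: "real l2"
    using l2_nth_summable[of x] by simp
  show ?thesis
  proof (rule bij_betw_byWitness[where f' = "\<lambda>x. Abs_l1 (\<lambda>n. (l2_nth x n)\<^sup>2)"])
    show "\<forall>p\<in>pos_simplex. Abs_l1 (\<lambda>n. (l2_nth (sqrt_map p) n)\<^sup>2) = p"
    proof
      fix p assume "p \<in> pos_simplex"
      then have "(l2_nth (sqrt_map p) n)\<^sup>2 = l1_nth p n" for n
        by (simp add: sqrt_map.rep_eq pos_simplex_def less_imp_le)
      then show "Abs_l1 (\<lambda>n. (l2_nth (sqrt_map p) n)\<^sup>2) = p"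
        by (simp add: l1_nth_inverse)
    qed
    show "\<forall>x\<in>pos_sphere. sqrt_map (Abs_l1 (\<lambda>n. (l2_nth x n)\<^sup>2)) = x"
      by (auto simp: pos_sphere_def sqrt_map.rep_eq Abs_l1_inverse[OF sq] less_imp_le intro!: l2_eqI)
    show "sqrt_map ` pos_simplex \<subseteq> pos_sphere"
    proof clarify
      fix p assume p: "p \<in> pos_simplex"
      have "(norm (sqrt_map p))\<^sup>2 = 1"
        using p unfolding norm_l2_eq by (simp add: sqrt_map.rep_eq pos_simplex_def less_imp_le)
      then have "norm (sqrt_map p) = 1"
        by (simp add: power2_eq_1_iff) (smt (verit) norm_ge_zero)
      with p show "sqrt_map p \<in> pos_sphere"
        by (auto simp: pos_sphere_def sqrt_map.rep_eq pos_simplex_def less_imp_neq[symmetric])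
    qed
    show "(\<lambda>x. Abs_l1 (\<lambda>n. (l2_nth x n)\<^sup>2)) ` pos_sphere \<subseteq> pos_simplex"
      using norm_l2_eq[where 'a = real]
      by (auto simp: pos_simplex_def pos_sphere_def Abs_l1_inverse[OF sq] less_imp_neq[symmetric])
        (metis one_power2)
  qed
qed

lift_definition l2_of_real :: "real l2 \<Rightarrow> complex l2" is "\<lambda>x n. complex_of_real (x n)"
  by simp

definition grad_flow_line_in_pos_sphere :: "(cp_inf \<Rightarrow> real) \<Rightarrow> (real \<Rightarrow> real l2) \<Rightarrow> bool" where
  "grad_flow_line_in_pos_sphere F x \<longleftrightarrow> (\<forall>t\<ge>0. x t \<in> pos_sphere) \<and>
     cp_integral_curve (cp_grad F) (\<lambda>t. cp_proj (l2_of_real (x t))) {0..}"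

definition lp_objective :: "real l2 \<Rightarrow> l1 \<Rightarrow> real" where
  "lp_objective c p = (\<Sum>n. l2_nth c n * l1_nth p n)"

end

theory Submission
  imports Defs
begin

text \<open>Every Hamiltonian in the theorem is the quadratic form \<open>\<langle>D z, z\<rangle>\<close> of a real diagonal operator \<open>D\<close>.
  On the sphere its Hamiltonian vector field lifts to \<open>- 2 \<i> D z\<close>; diagonal operators commute with
  each other and with \<open>\<i>\<close>, so all Poisson brackets vanish and the forms are mutually first integrals.
  The gradient lifts to \<open>2 (D z - \<langle>D z, z\<rangle> z)\<close>, whence \<open>p n = \<bar>z n\<bar>\<^sup>2\<close> solves the replicator equation
  \<open>p' n = 4 (c n - H) p n\<close> along the gradient flow. There \<open>p n / p 0\<close> is a constant multiple of
  \<open>exp (4 (c n - c 0) t)\<close>, so \<open>p\<close> tends to the vertex of the simplex at the largest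
  coefficient \<open>c 0\<close>.\<close>

section \<open>Diagonal operators\<close>

lemma l2_nth_le_norm: "norm (l2_nth x n) \<le> norm x"
proof -
  have "(norm (l2_nth x n))\<^sup>2 = (\<Sum>k\<in>{n}. (norm (l2_nth x k))\<^sup>2)" by simp
  also have "\<dots> \<le> (\<Sum>k. (norm (l2_nth x k))\<^sup>2)"
    by (intro sum_le_suminf l2_nth_summable) auto
  finally show ?thesis by (simp flip: norm_l2_eq)
qed

text \<open>Bounded coefficients would suffice for an operator; square-summable ones cover
  \<open>c\<close> and the multiples of unit vectors, and their norm serves as the bound.\<close>

lift_definition l2_diag :: "real l2 \<Rightarrow> complex l2 \<Rightarrow> complex l2" is "\<lambda>a z n. a n *\<^sub>R z n"
proof -
  fix a :: "nat \<Rightarrow> real" and z :: "nat \<Rightarrow> complex"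
  assume a: "summable (\<lambda>n. (norm (a n))\<^sup>2)" and z: "summable (\<lambda>n. (norm (z n))\<^sup>2)"
  have "(norm (a n))\<^sup>2 \<le> (norm (Abs_l2 a))\<^sup>2" for n
    using l2_nth_le_norm[of "Abs_l2 a" n] a by (intro power_mono) (simp_all add: Abs_l2_inverse)
  then show "summable (\<lambda>n. (norm (a n *\<^sub>R z n))\<^sup>2)"
    by (intro summable_comparison_test'[OF summable_mult[OF z, of "(norm (Abs_l2 a))\<^sup>2"]])
      (simp add: power_mult_distrib mult_right_mono)
qed

lift_definition l2_unit :: "nat \<Rightarrow> real l2" is "\<lambda>k n. if n = k then 1 else 0"
  by (rule summable_finite[of "{k}" for k]) auto

lemma norm_l2_diag: "norm (l2_diag a z) \<le> norm z * norm a"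
proof (rule power2_le_imp_le)
  have "(norm (l2_diag a z))\<^sup>2 = (\<Sum>n. (norm (l2_nth (l2_diag a z) n))\<^sup>2)"
    by (rule norm_l2_eq)
  also have "\<dots> \<le> (\<Sum>n. (norm a)\<^sup>2 * (norm (l2_nth z n))\<^sup>2)"
  proof (rule suminf_le)
    show "(norm (l2_nth (l2_diag a z) n))\<^sup>2 \<le> (norm a)\<^sup>2 * (norm (l2_nth z n))\<^sup>2" for n
      using l2_nth_le_norm[of a n]
      by (simp add: l2_diag.rep_eq power_mult_distrib mult_right_mono abs_le_square_iff[symmetric])
  qed (intro l2_nth_summable summable_mult)+
  also have "\<dots> = (norm z * norm a)\<^sup>2"
    unfolding suminf_mult[OF l2_nth_summable] by (simp add: norm_l2_eq power_mult_distrib)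
  finally show "(norm (l2_diag a z))\<^sup>2 \<le> (norm z * norm a)\<^sup>2" .
qed simp

lemma bounded_linear_l2_diag: "bounded_linear (l2_diag a)"
  by (rule bounded_linear_intro[of _ "norm a"]; (rule norm_l2_diag)?)
    (transfer, simp add: fun_eq_iff algebra_simps)+

lemma l2_diag_cscale: "l2_diag a (l2_cscale b z) = l2_cscale b (l2_diag a z)"
  by transfer simp

text \<open>Real coefficients make the operator self-adjoint; the last inner product is flipped so
  that both sides have the same shape.\<close>

lemma l2_diag_symmetric: "inner (l2_diag a z) w = inner (l2_diag a w) z"
  by transfer (simp add: inner_commute)

text \<open>In every coordinate the two vectors are real multiples of \<open>z n\<close> and of
  \<open>\<i> * z n\<close>, which are orthogonal. All brackets vanish for this reason.\<close>

lemma inner_diag_i_diag: "inner (l2_diag a z) (l2_cscale \<i> (l2_diag b z)) = 0"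
  by transfer (simp add: inner_complex_def algebra_simps)

text \<open>Infinitesimal circle invariance: the form does not change along the orbit direction
  \<open>\<i> z\<close>, so vertical components of velocities never contribute.\<close>

lemma inner_diag_i: "inner (l2_diag a z) (l2_cscale \<i> z) = 0"
  by transfer (simp add: inner_complex_def algebra_simps)

lemma inner_diag: "inner (l2_diag a z) z = (\<Sum>n. l2_nth a n * (cmod (l2_nth z n))\<^sup>2)"
  by transfer (simp add: power2_norm_eq_inner)

lemma l2_cscale_i_i [simp]: "l2_cscale \<i> (l2_cscale \<i> z) = - z"
  by transfer simp

lemma l2_cscale_diff: "l2_cscale b (z - w) = l2_cscale b z - l2_cscale b w"
  by transfer (auto simp: algebra_simps)

lemma diag_form_has_derivative:
  "((\<lambda>z. inner (l2_diag a z) z) has_derivative (\<lambda>v. 2 * inner (l2_diag a z) v)) (at z within S)"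
proof -
  have D: "(l2_diag a has_derivative l2_diag a) (at z within S)"
    by (rule bounded_linear_imp_has_derivative[OF bounded_linear_l2_diag])
  show ?thesis
    by (rule has_derivative_eq_rhs[OF has_derivative_inner[OF D has_derivative_ident]])
      (simp add: fun_eq_iff l2_diag_symmetric[of a _ z])
qed

lemma diag_form_vector_derivative:
  assumes "(\<zeta> has_vector_derivative v) (at t within J)"
  shows "((\<lambda>s. inner (l2_diag a (\<zeta> s)) (\<zeta> s)) has_real_derivative
    2 * inner (l2_diag a (\<zeta> t)) v) (at t within J)"
  unfolding has_field_derivative_def
  by (rule has_derivative_eq_rhs[OF diff_chain_within[OF assms[unfolded has_vector_derivative_def]
      diag_form_has_derivative], unfolded o_def])
    (simp add: fun_eq_iff)

section \<open>Smoothness\<close>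

lemma smooth_on_const:
  fixes S :: "'a::real_normed_vector set" and k :: "'b::real_normed_vector"
  shows "smooth_on S (\<lambda>_. k)"
proof -
  have "higher_differentiable_on m S (\<lambda>_. k)" for m and k :: 'b
  proof (induction m arbitrary: k)
    case (Suc m)
    have "frechet_derivative (\<lambda>_. k) (at x) = (\<lambda>_. 0)" for x :: 'a
      using frechet_derivative_at[OF has_derivative_const[of k]] by metis
    then show ?case
      using Suc[of 0] by simp
  qed simp
  then show ?thesis unfolding smooth_on_def by blast
qed

text \<open>Smoothness is inherited from the directional derivatives, so a quadratic form is smooth
  because linear maps are, and these because constants are.\<close>

lemma smooth_on_step:
  assumes "\<And>x. (f has_derivative f' x) (at x)" "\<And>v. smooth_on S (\<lambda>x. f' x v)"
  shows "smooth_on S f"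
  unfolding smooth_on_def
proof
  fix k
  have eq: "(\<lambda>x. frechet_derivative f (at x) v) = (\<lambda>x. f' x v)" for v
    unfolding frechet_derivative_at[OF assms(1), symmetric] by (rule refl)
  show "higher_differentiable_on k S f"
  proof (cases k)
    case 0
    have "continuous_on S f"
      by (intro continuous_at_imp_continuous_on ballI has_derivative_continuous[OF assms(1)])
    then show ?thesis by (simp add: 0)
  next
    case (Suc m)
    have "f differentiable (at x)" for x
      using assms(1) unfolding differentiable_def by blast
    moreover have "higher_differentiable_on m S (\<lambda>x. f' x v)" for v
      using assms(2) unfolding smooth_on_def by blast
    ultimately show ?thesis by (simp add: Suc eq)
  qed
qed

lemma smooth_on_bounded_linear: "bounded_linear f \<Longrightarrow> smooth_on S f"
  by (rule smooth_on_step[of _ "\<lambda>_. f"])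
    (auto intro: bounded_linear_imp_has_derivative smooth_on_const)

lemma smooth_on_diag_form: "smooth_on S (\<lambda>z. inner (l2_diag a z) z)"
proof (rule smooth_on_step[OF diag_form_has_derivative])
  fix v
  have "bounded_linear (\<lambda>z. 2 * inner (l2_diag a z) v)"
    by (intro bounded_linear_const_mult bounded_linear_inner_left_comp bounded_linear_l2_diag)
  then show "smooth_on S (\<lambda>z. 2 * inner (l2_diag a z) v)"
    by (rule smooth_on_bounded_linear)
qed

text \<open>The quotient is partial: lifted constants can be evaluated only at representatives
  related to themselves, and these are the unit vectors.\<close>

lemma cp_rel_refl: "cp_rel z z \<longleftrightarrow> norm z = 1"
proof -
  have "\<exists>t. z = l2_cscale (cis t) z"
    by (rule exI[of _ 0]) (simp add: l2_cscale_simps)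
  then show ?thesis unfolding cp_rel_def by blast
qed

lemma cp_H_proj: "norm z = 1 \<Longrightarrow> cp_H a (cp_proj z) = inner (l2_diag a z) z"
  by (simp add: cp_H.abs_eq cp_rel_refl inner_diag)

lemma cp_smooth_cp_H: "cp_smooth (cp_H a)"
  unfolding cp_smooth_def
\<comment> \<open>The quadratic form extends the function to the whole space, so the neighbourhood
  is \<open>UNIV\<close>.\<close>
proof (rule exI, rule exI, intro conjI ballI)
  show "smooth_on UNIV (\<lambda>z. inner (l2_diag a z) z)" by (rule smooth_on_diag_form)
  show "inner (l2_diag a z) z = cp_H a (cp_proj z)" if "z \<in> sphere 0 1" for z
    using that by (simp add: cp_H_proj)
qed simp_all

section \<open>Tangent vectors and differentials\<close>

lemma cp_proj_cases:
  obtains z where "norm z = 1" "p = cp_proj z"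
proof -
  have "cp_rel (rep_cp p) (rep_cp p)" "cp_proj (rep_cp p) = p"
    by (rule Quotient3_rep_reflp[OF Quotient3_cp_inf] Quotient3_abs_rep[OF Quotient3_cp_inf])+
  then show thesis using that cp_rel_refl by metis
qed

text \<open>Each component is again a Hamiltonian of the form \<open>cp_H\<close>, so every result
  about two forms \<open>cp_H a\<close> and \<open>cp_H b\<close> covers it.\<close>

lemma cp_H_comp_eq: "cp_H_comp c n = cp_H (l2_nth c n *\<^sub>R l2_unit n)"
proof
  fix p
  obtain z where z: "norm z = 1" "p = cp_proj z" by (rule cp_proj_cases)
  have "cp_H (l2_nth c n *\<^sub>R l2_unit n) p = l2_nth c n * (cmod (l2_nth z n))\<^sup>2"
    unfolding z(2) cp_H_proj[OF z(1)] inner_diag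
    by (subst suminf_finite[of "{n}"]) (auto simp: scaleR_l2.rep_eq l2_unit.rep_eq)
  then show "cp_H_comp c n p = cp_H (l2_nth c n *\<^sub>R l2_unit n) p"
    using z by (simp add: cp_H_comp.abs_eq cp_rel_refl)
qed

lemma cp_proj_eq_iff:
  assumes "norm z = 1" "norm w = 1"
  shows "cp_proj z = cp_proj w \<longleftrightarrow> (\<exists>t. w = l2_cscale (cis t) z)"
  using Quotient3_rel[OF Quotient3_cp_inf, of z w] assms cp_rel_refl unfolding cp_rel_def by blast

lemma cp_tangent_rel_refl: "cp_tangent_rel (z, v) (z, v) \<longleftrightarrow> sphere_tangent z v"
proof -
  have "\<exists>t s. z = l2_cscale (cis t) z \<and> v = l2_cscale (cis t) v + s *\<^sub>R l2_cscale \<i> z"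
    by (rule exI[of _ 0], rule exI[of _ 0]) (simp add: l2_cscale_simps)
  then show ?thesis unfolding cp_tangent_rel_def by blast
qed

lemma cp_base_dproj: "sphere_tangent z v \<Longrightarrow> cp_base (cp_dproj z v) = cp_proj z"
  by (simp add: cp_dproj_def cp_base.abs_eq cp_tangent_rel_refl)

lemma cp_dproj_in_tangent_space: "sphere_tangent z v \<Longrightarrow> cp_dproj z v \<in> cp_tangent_space (cp_proj z)"
  by (simp add: cp_tangent_space_def cp_base_dproj)

text \<open>A representative may sit elsewhere on the orbit of \<open>z\<close>; the circle action
  carries it to \<open>z\<close> without changing its class.\<close>

lemma cp_tangent_space_cases:
  assumes "X \<in> cp_tangent_space (cp_proj z)" "norm z = 1"
  obtains v where "sphere_tangent z v" "X = cp_dproj z v"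
proof -
  obtain w u where wu: "sphere_tangent w u" "X = cp_dproj w u"
  proof -
    have "cp_tangent_rel (rep_cp_tangent X) (rep_cp_tangent X)"
      "abs_cp_tangent (rep_cp_tangent X) = X"
      by (rule Quotient3_rep_reflp[OF Quotient3_cp_tangent] Quotient3_abs_rep[OF Quotient3_cp_tangent])+
    then show thesis
      using that by (metis cp_dproj_def cp_tangent_rel_refl surj_pair)
  qed
  then have "cp_proj w = cp_proj z"
    using assms cp_base_dproj by (simp add: cp_tangent_space_def)
  then obtain t where t: "z = l2_cscale (cis t) w"
    using wu(1) assms(2) cp_proj_eq_iff unfolding sphere_tangent_def by blast
  let ?v = "l2_cscale (cis t) u"
  have v: "sphere_tangent z ?v"
    using wu(1) by (simp add: sphere_tangent_def t)
  have "cp_dproj w u = cp_dproj z ?v"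
    unfolding cp_dproj_eq_iff[OF wu(1) v] using t by (intro exI[of _ t] exI[of _ 0]) simp
  then show thesis using that v wu(2) by blast
qed

lemma cp_dproj_add_vertical:
  assumes "sphere_tangent z v"
  shows "sphere_tangent z (v + s *\<^sub>R l2_cscale \<i> z)" "cp_dproj z (v + s *\<^sub>R l2_cscale \<i> z) = cp_dproj z v"
proof -
  show v: "sphere_tangent z (v + s *\<^sub>R l2_cscale \<i> z)"
    using assms by (simp add: sphere_tangent_def inner_add_right inner_commute[of z "l2_cscale \<i> z"]
      inner_i_cscale)
  show "cp_dproj z (v + s *\<^sub>R l2_cscale \<i> z) = cp_dproj z v"
    unfolding cp_dproj_eq_iff[OF v assms]
    by (intro exI[of _ 0] exI[of _ "-s"]) (simp add: l2_cscale_simps)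
qed

lemma cp_dproj_same_base:
  assumes "sphere_tangent z v" "sphere_tangent z w" "cp_dproj z v = cp_dproj z w"
  obtains s where "w = v + s *\<^sub>R l2_cscale \<i> z"
proof -
  \<comment> \<open>The zero vector fills the second slot of \<open>cp_dproj_common_base\<close>,
    which speaks of pairs.\<close>
  have z0: "sphere_tangent z 0" using assms(1) by (simp add: sphere_tangent_def)
  from cp_dproj_common_base[OF assms(1) z0 assms(2) z0 assms(3) refl]
  obtain t s where t: "z = l2_cscale (cis t) z" "w = l2_cscale (cis t) (v + s *\<^sub>R l2_cscale \<i> z)"
    by metis
  \<comment> \<open>The circle acts freely on the sphere, so a rotation that fixes \<open>z\<close>
    is trivial.\<close>
  have "l2_cscale (cis t - 1) z = 0"
    using t(1) by (metis l2_cscale_simps(2,4) diff_add_cancel add_cancel_left_left)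
  then have "cmod (cis t - 1) * norm z = 0" by (metis norm_l2_cscale norm_zero)
  then have "cis t = 1" using assms(1) by (auto simp: sphere_tangent_def)
  with t(2) show thesis by (intro that[of s]) (simp add: l2_cscale_simps)
qed

text \<open>Along the great circle \<open>cos t * z + sin t * u\<close> in the sphere the derivative within the sphere is the
  derivative of a function of one real variable.\<close>

lemma sphere_derivative_unique:
  fixes f :: "complex l2 \<Rightarrow> real"
  assumes "(f has_derivative D) (at z within sphere 0 1)"
    "(f has_derivative D') (at z within sphere 0 1)" "sphere_tangent z v"
  shows "D v = D' v"
proof (cases "v = 0")
  case True
  then show ?thesis
    using assms(1,2) by (metis has_derivative_bounded_linear linear_simps(3))
next
  case False
  define u where "u = v /\<^sub>R norm v"
  have u: "norm u = 1" "inner z u = 0" "norm z = 1" "v = norm v *\<^sub>R u"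
    using False assms(3) by (auto simp: u_def sphere_tangent_def)
  define \<gamma> where "\<gamma> s = cos s *\<^sub>R z + sin s *\<^sub>R u" for s :: real
  have "inner (\<gamma> s) (\<gamma> s) = 1" for s
  proof -
    have "inner (\<gamma> s) (\<gamma> s) = (cos s)\<^sup>2 * inner z z + (sin s)\<^sup>2 * inner u u"
      using u(2) by (simp add: \<gamma>_def inner_add_left inner_add_right inner_commute[of u z]
        power2_eq_square)
    also have "\<dots> = 1"
      using u(1,3) by (simp add: norm_eq_1)
    finally show ?thesis .
  qed
  then have \<gamma>: "range \<gamma> \<subseteq> sphere 0 1" by (auto simp: norm_eq_1)
  have d: "(\<gamma> has_derivative (\<lambda>h. h *\<^sub>R u)) (at 0)"
    unfolding \<gamma>_def by (auto intro!: derivative_eq_intros)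
  have chain: "(f \<circ> \<gamma> has_derivative (E \<circ> (\<lambda>h. h *\<^sub>R u))) (at 0)"
    if "(f has_derivative E) (at z within sphere 0 1)" for E
    using that has_derivative_subset[OF _ \<gamma>] d
    by (intro diff_chain_within) (auto simp: \<gamma>_def)
  have "E v = norm v * E u" if "(f has_derivative E) (at z within sphere 0 1)" for E
    using has_derivative_bounded_linear[OF that] u(4) by (metis linear_simps(5) real_scaleR_def)
  moreover have "D u = D' u"
    using has_derivative_unique[OF chain[OF assms(1)] chain[OF assms(2)]]
    by (auto simp: fun_eq_iff dest: spec[of _ 1])
  ultimately show ?thesis using assms(1,2) by metis
qed

lemma cp_H_has_derivative:
  assumes "norm z = 1"
  shows "((\<lambda>w. cp_H a (cp_proj w)) has_derivative (\<lambda>v. 2 * inner (l2_diag a z) v))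
    (at z within sphere 0 1)"
  by (rule has_derivative_transform[OF _ _ diag_form_has_derivative])
    (use assms in \<open>auto simp: cp_H_proj\<close>)

lemma cp_differential_cp_H:
  assumes "sphere_tangent z v"
  shows "cp_differential (cp_H a) (cp_dproj z v) = 2 * inner (l2_diag a z) v"
  unfolding cp_differential_def
proof (rule the_equality)
  show "\<exists>z' v' D. sphere_tangent z' v' \<and> cp_dproj z v = cp_dproj z' v' \<and>
     ((\<lambda>w. cp_H a (cp_proj w)) has_derivative D) (at z' within sphere 0 1) \<and>
     2 * inner (l2_diag a z) v = D v'"
    using assms cp_H_has_derivative
    by (intro exI[of _ z] exI[of _ v] exI[of _ "\<lambda>v. 2 * inner (l2_diag a z) v"])
      (auto simp: sphere_tangent_def)
next
  fix b assume "\<exists>z' v' D. sphere_tangent z' v' \<and> cp_dproj z v = cp_dproj z' v' \<and>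
     ((\<lambda>w. cp_H a (cp_proj w)) has_derivative D) (at z' within sphere 0 1) \<and> b = D v'"
  then obtain y u D where y: "sphere_tangent y u" "cp_dproj z v = cp_dproj y u"
    "((\<lambda>w. cp_H a (cp_proj w)) has_derivative D) (at y within sphere 0 1)" "b = D u"
    by blast
  obtain t s where t: "y = l2_cscale (cis t) z" "u = l2_cscale (cis t) v + s *\<^sub>R l2_cscale \<i> y"
    using y(2) cp_dproj_eq_iff[OF assms y(1)] by blast
  have "b = 2 * inner (l2_diag a y) u"
    using sphere_derivative_unique[OF y(3) cp_H_has_derivative y(1)] y(1,4)
    by (simp add: sphere_tangent_def)
  \<comment> \<open>Independence of the representative: the vertical term drops out, and the
    rotation commutes with the operator and is an isometry.\<close>
  also have "\<dots> = 2 * inner (l2_diag a z) v"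
    unfolding t(2) inner_add_right inner_scaleR_right inner_diag_i
    by (simp add: t(1) l2_diag_cscale)
  finally show "b = 2 * inner (l2_diag a z) v" .
qed

section \<open>Hamiltonian vector fields and first integrals\<close>

lemma cp_ham_vf_lift_tangent:
  "norm z = 1 \<Longrightarrow> sphere_tangent z (- 2 *\<^sub>R l2_cscale \<i> (l2_diag a z))"
  using inner_diag_i[of a z] l2_diag_symmetric[of a "l2_cscale \<i> z" z]
  by (simp add: sphere_tangent_def inner_commute[of z] l2_diag_cscale)

text \<open>Multiplying the lift by \<open>\<i>\<close> gives half of the pairing:
  \<open>\<i> X = 2 D z\<close> represents the differential. Uniqueness is nondegeneracy of the form
  on the quotient.\<close>

lemma cp_ham_vf_cp_H:
  assumes z: "norm z = 1"
  shows "cp_ham_vf (cp_H a) (cp_proj z) = cp_dproj z (- 2 *\<^sub>R l2_cscale \<i> (l2_diag a z))"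
    (is "_ = cp_dproj z ?X")
  unfolding cp_ham_vf_def
proof (rule the_equality)
  have X: "sphere_tangent z ?X" by (rule cp_ham_vf_lift_tangent[OF z])
  have iX: "l2_cscale \<i> ?X = 2 *\<^sub>R l2_diag a z"
    by (simp add: l2_cscale_simps(5) del: scaleR_minus_left) simp
  have form: "fs_form (cp_dproj z ?X) (cp_dproj z w) = cp_differential (cp_H a) (cp_dproj z w)"
    if "sphere_tangent z w" for w
    using that by (simp only: fs_form_eq[OF X] cp_differential_cp_H l2_omega_eq_inner iX) simp
  then show "cp_dproj z ?X \<in> cp_tangent_space (cp_proj z) \<and>
    (\<forall>Y\<in>cp_tangent_space (cp_proj z). fs_form (cp_dproj z ?X) Y = cp_differential (cp_H a) Y)"
    using cp_dproj_in_tangent_space[OF X] cp_tangent_space_cases[OF _ z] by metis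
  fix Y assume Y: "Y \<in> cp_tangent_space (cp_proj z) \<and>
    (\<forall>Z\<in>cp_tangent_space (cp_proj z). fs_form Y Z = cp_differential (cp_H a) Z)"
  then obtain v where v: "sphere_tangent z v" "Y = cp_dproj z v"
    using cp_tangent_space_cases[OF _ z] by blast
  define d where "d = l2_cscale \<i> (v - ?X)"
  have orth: "inner d w = 0" if w: "sphere_tangent z w" for w
  proof -
    have "fs_form Y (cp_dproj z w) = fs_form (cp_dproj z ?X) (cp_dproj z w)"
      using Y form[OF w] cp_dproj_in_tangent_space[OF w] by simp
    then have "l2_omega v w = l2_omega ?X w"
      unfolding v(2) using fs_form_eq v(1) X w by metis
    then show ?thesis
      unfolding d_def l2_cscale_diff inner_diff_left l2_omega_eq_inner by simp
  qed
  \<comment> \<open>The tangential part of \<open>d\<close>. As \<open>d\<close> is orthogonal to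
    all tangent vectors it vanishes, so \<open>d\<close> is a multiple of \<open>z\<close> and
    \<open>v - ?X\<close> is vertical.\<close>
  define w where "w = d - inner z d *\<^sub>R z"
  have "sphere_tangent z w"
    using z by (simp add: sphere_tangent_def w_def inner_diff_right norm_eq_1)
  then have "inner d w = 0" "inner z w = 0"
    using orth by (auto simp: sphere_tangent_def)
  then have "inner w w = 0"
    by (subst (1) w_def) (simp add: inner_diff_left)
  then have "d = inner z d *\<^sub>R z" by (simp add: w_def)
  then have "l2_cscale \<i> d = inner z d *\<^sub>R l2_cscale \<i> z"
    by (metis l2_cscale_simps(5))
  moreover have "l2_cscale \<i> d = ?X - v" by (simp only: d_def l2_cscale_i_i minus_diff_eq)
  ultimately have "v = ?X + (- inner z d) *\<^sub>R l2_cscale \<i> z"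
    by (metis add_diff_cancel_left' diff_add_cancel minus_diff_eq scaleR_minus_left add.commute)
  then show "Y = cp_dproj z ?X"
    using cp_dproj_add_vertical(2)[OF X] v(2) by metis
qed

lemma cp_poisson_cp_H: "cp_poisson (cp_H a) (cp_H b) p = 0"
proof -
  obtain z where z: "norm z = 1" "p = cp_proj z" by (rule cp_proj_cases)
  have "cp_poisson (cp_H a) (cp_H b) p =
    l2_omega (- 2 *\<^sub>R l2_cscale \<i> (l2_diag a z)) (- 2 *\<^sub>R l2_cscale \<i> (l2_diag b z))"
    unfolding cp_poisson_def z(2) cp_ham_vf_cp_H[OF z(1)]
    by (intro fs_form_eq cp_ham_vf_lift_tangent z(1))
  also have "\<dots> = 0"
    unfolding l2_omega_eq_inner l2_cscale_simps(5) inner_scaleR_left inner_scaleR_right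
      l2_cscale_i_i inner_minus_left inner_diag_i_diag by simp
  finally show ?thesis .
qed

text \<open>The limit point assumption excludes \<open>J = {t}\<close>, where every \<open>v\<close> is a derivative within \<open>J\<close>,
  tangent or not.\<close>

lemma lift_velocity_tangent:
  assumes v: "(\<zeta> has_vector_derivative v) (at t within J)" and e: "e > 0"
    and n: "\<And>s. s \<in> J \<inter> ball t e \<Longrightarrow> norm (\<zeta> s) = 1" and t: "t \<in> J" "t islimpt J"
  shows "sphere_tangent (\<zeta> t) v"
proof -
  have "((\<lambda>s. inner (\<zeta> s) (\<zeta> s)) has_derivative
    (\<lambda>h. inner (\<zeta> t) (h *\<^sub>R v) + inner (h *\<^sub>R v) (\<zeta> t))) (at t within J)"
    using v unfolding has_vector_derivative_def by (intro has_derivative_inner)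
  then have "((\<lambda>s. inner (\<zeta> s) (\<zeta> s)) has_vector_derivative 2 * inner (\<zeta> t) v) (at t within J)"
    by (simp add: has_vector_derivative_def inner_commute mult_ac)
  moreover have "((\<lambda>s. inner (\<zeta> s) (\<zeta> s)) has_vector_derivative 0) (at t within J)"
    by (rule has_vector_derivative_transform_within[OF has_vector_derivative_const[of 1] e t(1)])
      (use n in \<open>auto simp: norm_eq_1 dist_commute\<close>)
  ultimately have "2 * inner (\<zeta> t) v = 0"
    using t(2) by (intro vector_derivative_unique_within) (auto simp: trivial_limit_within)
  then show ?thesis using n[of t] t(1) e by (simp add: sphere_tangent_def)
qed

text \<open>The chain rule along a local lift to the sphere. Hamiltonian and gradient flows both use
  it, differing only in what \<open>X\<close> says about \<open>v\<close>.\<close>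

lemma cp_H_along_velocity:
  assumes V: "cp_has_velocity \<gamma> X t J" and t: "t \<in> J" "t islimpt J"
  obtains z v where "norm z = 1" "cp_proj z = \<gamma> t" "sphere_tangent z v" "X = cp_dproj z v"
    "\<And>b. ((\<lambda>s. cp_H b (\<gamma> s)) has_real_derivative 2 * inner (l2_diag b z) v) (at t within J)"
proof -
  obtain \<zeta> v e where *: "e > 0" "\<And>s. s \<in> J \<inter> ball t e \<Longrightarrow> norm (\<zeta> s) = 1 \<and> cp_proj (\<zeta> s) = \<gamma> s"
    "(\<zeta> has_vector_derivative v) (at t within J)" "X = cp_dproj (\<zeta> t) v"
    using V unfolding cp_has_velocity_def by blast
  show thesis
  proof (rule that[of "\<zeta> t" v])
    show "norm (\<zeta> t) = 1" "cp_proj (\<zeta> t) = \<gamma> t"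
      using *(2)[of t] *(1) t(1) by auto
    show "sphere_tangent (\<zeta> t) v"
      by (rule lift_velocity_tangent[OF *(3,1) _ t]) (use *(2) in blast)
    show "X = cp_dproj (\<zeta> t) v" by fact
    fix b
    show "((\<lambda>s. cp_H b (\<gamma> s)) has_real_derivative 2 * inner (l2_diag b (\<zeta> t)) v) (at t within J)"
    proof (rule has_field_derivative_transform_within[OF diag_form_vector_derivative[OF *(3)] *(1) t(1)])
      fix s assume "s \<in> J" "dist s t < e"
      then show "inner (l2_diag b (\<zeta> s)) (\<zeta> s) = cp_H b (\<gamma> s)"
        using *(2)[of s] cp_H_proj[of "\<zeta> s" b] by (simp add: dist_commute)
    qed
  qed
qed

lemma cp_first_integral_cp_H: "cp_first_integral (cp_H a) (cp_H b)"
  unfolding cp_first_integral_def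
proof (intro allI impI ballI)
  fix \<gamma> J s t
  assume J: "cp_integral_curve (cp_ham_vf (cp_H a)) \<gamma> J" "s \<in> J" "t \<in> J"
  then have "is_interval J" by (simp add: cp_integral_curve_def)
  then have conv: "convex J" "connected J"
    by (auto simp: is_interval_convex is_interval_connected)
  show "cp_H b (\<gamma> s) = cp_H b (\<gamma> t)"
  proof (cases "s = t")
    case False
    have "((\<lambda>s. cp_H b (\<gamma> s)) has_real_derivative 0) (at r within J)" if r: "r \<in> J" for r
    proof -
      \<comment> \<open>Two distinct points make the interval nondegenerate, so it has no isolated
        points.\<close>
      have lim: "r islimpt J"
        using connected_imp_perfect[OF conv(2) r] J(2,3) False by blast
      have V: "cp_has_velocity \<gamma> (cp_ham_vf (cp_H a) (\<gamma> r)) r J"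
        using J(1) r by (simp add: cp_integral_curve_def)
      obtain z v where z: "norm z = 1" "cp_proj z = \<gamma> r" "sphere_tangent z v"
        "cp_ham_vf (cp_H a) (\<gamma> r) = cp_dproj z v"
        "((\<lambda>s. cp_H b (\<gamma> s)) has_real_derivative 2 * inner (l2_diag b z) v) (at r within J)"
        using cp_H_along_velocity[OF V r lim] by metis
      \<comment> \<open>The lifted velocity agrees with the standard lift only up to a vertical
        vector; \<open>l2_diag b z\<close> is orthogonal to both.\<close>
      have "cp_dproj z (- 2 *\<^sub>R l2_cscale \<i> (l2_diag a z)) = cp_dproj z v"
        using cp_ham_vf_cp_H[OF z(1)] z(2,4) by metis
      then obtain q where "v = - 2 *\<^sub>R l2_cscale \<i> (l2_diag a z) + q *\<^sub>R l2_cscale \<i> z"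
        using cp_dproj_same_base[OF cp_ham_vf_lift_tangent[OF z(1)] z(3)] by metis
      then have "inner (l2_diag b z) v = 0"
        by (simp add: inner_add_right inner_diff_right inner_diag_i inner_diag_i_diag)
      with z(5) show ?thesis by simp
    qed
    then show ?thesis
      using has_field_derivative_zero_constant[OF conv(1)] J(2,3) by metis
  qed simp
qed

section \<open>Linear independence\<close>

text \<open>Coordinate points read off single coefficients, which is what separates the members of a
  family in a linear relation.\<close>

lemma cp_H_at_unit:
  "norm (l2_of_real (l2_unit m)) = 1"
  "cp_H a (cp_proj (l2_of_real (l2_unit m))) = l2_nth a m"
proof -
  have nth: "l2_nth (l2_of_real (l2_unit m)) k = (if k = m then 1 else 0)" for k
    by (simp add: l2_of_real.rep_eq l2_unit.rep_eq)
  have s: "(\<Sum>k. f k * (cmod (l2_nth (l2_of_real (l2_unit m)) k))\<^sup>2) = f m" for f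
    by (subst suminf_finite[of "{m}"]) (auto simp: nth)
  have "(norm (l2_of_real (l2_unit m)))\<^sup>2 = 1"
    using s[of "\<lambda>_. 1"] by (simp add: norm_l2_eq)
  then show n: "norm (l2_of_real (l2_unit m)) = 1"
    by (simp add: power2_eq_1_iff) (smt (verit) norm_ge_zero)
  show "cp_H a (cp_proj (l2_of_real (l2_unit m))) = l2_nth a m"
    unfolding cp_H_proj[OF n] inner_diag by (rule s)
qed

lemma lin_indep_family_cp_H_unit:
  assumes "\<And>n. n \<in> I \<Longrightarrow> b n \<noteq> 0"
  shows "lin_indep_family I (\<lambda>n. cp_H (b n *\<^sub>R l2_unit n))"
  unfolding lin_indep_family_def
proof (intro allI impI ballI)
  fix K and \<alpha> :: "nat \<Rightarrow> real" and m
  assume K: "finite K" "K \<subseteq> I" "\<forall>p. (\<Sum>i\<in>K. \<alpha> i * cp_H (b i *\<^sub>R l2_unit i) p) = 0" "m \<in> K"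
  have "0 = (\<Sum>i\<in>K. \<alpha> i * cp_H (b i *\<^sub>R l2_unit i) (cp_proj (l2_of_real (l2_unit m))))"
    using K(3) by simp
  also have "\<dots> = (\<Sum>i\<in>K. if i = m then \<alpha> i * b i else 0)"
    by (rule sum.cong) (auto simp: cp_H_at_unit scaleR_l2.rep_eq l2_unit.rep_eq)
  also have "\<dots> = \<alpha> m * b m" using K(1,4) by simp
  finally show "\<alpha> m = 0" using assms K(2,4) by auto
qed

section \<open>The gradient flow\<close>

text \<open>\<open>X\<close> is the gradient \<open>2 D z\<close> of the form in the ambient space,
  projected to the tangent space of the sphere. Circle invariance makes it horizontal, so the metric
  pairs it like the ambient inner product.\<close>

lemma cp_grad_cp_H:
  fixes a
  assumes z: "norm z = 1"
  defines "X \<equiv> 2 *\<^sub>R (l2_diag a z - inner (l2_diag a z) z *\<^sub>R z)"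
  shows "sphere_tangent z X" "cp_grad (cp_H a) (cp_proj z) = cp_dproj z X"
proof -
  have zz: "inner z z = 1" using z by (simp add: norm_eq_1)
  show X: "sphere_tangent z X"
    using z zz by (simp add: sphere_tangent_def X_def inner_diff_right inner_commute[of z "l2_diag a z"])
  have iX: "inner (l2_cscale \<i> z) X = 0"
    by (simp add: X_def inner_diff_right inner_i_cscale inner_commute[of "l2_cscale \<i> z" "l2_diag _ _"]
        inner_diag_i)
  then have hX: "horizontal_part z X = X"
    by (simp add: horizontal_part_def)
  have metric: "fs_metric (cp_dproj z X) (cp_dproj z w) = cp_differential (cp_H a) (cp_dproj z w)"
    if w: "sphere_tangent z w" for w
  proof -
    have "fs_metric (cp_dproj z X) (cp_dproj z w) = inner X (horizontal_part z w)"
      using fs_metric_eq[OF X w] hX by simp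
    also have "\<dots> = inner X w"
      using iX by (simp add: horizontal_part_def inner_diff_right inner_commute[of X])
    also have "\<dots> = 2 * inner (l2_diag a z) w"
      using w by (simp add: X_def inner_diff_left sphere_tangent_def)
    finally show ?thesis using cp_differential_cp_H[OF w] by simp
  qed
  show "cp_grad (cp_H a) (cp_proj z) = cp_dproj z X"
    unfolding cp_grad_def
  proof (rule the_equality)
    show "cp_dproj z X \<in> cp_tangent_space (cp_proj z) \<and>
      (\<forall>Y\<in>cp_tangent_space (cp_proj z). fs_metric (cp_dproj z X) Y = cp_differential (cp_H a) Y)"
      using metric cp_dproj_in_tangent_space[OF X] cp_tangent_space_cases[OF _ z] by metis
    fix Y assume Y: "Y \<in> cp_tangent_space (cp_proj z) \<and>
      (\<forall>Z\<in>cp_tangent_space (cp_proj z). fs_metric Y Z = cp_differential (cp_H a) Z)"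
    then obtain v where v: "sphere_tangent z v" "Y = cp_dproj z v"
      using cp_tangent_space_cases[OF _ z] by blast
    \<comment> \<open>The difference of two horizontal representatives is an admissible test vector;
      tested against itself it must vanish.\<close>
    define w where "w = horizontal_part z v - X"
    have w: "sphere_tangent z w"
      using v(1) X by (simp add: sphere_tangent_def w_def horizontal_part_def inner_diff_right
        inner_commute[of z "l2_cscale \<i> z"] inner_i_cscale)
    have "inner (l2_cscale \<i> z) w = 0"
      using iX zz by (simp add: w_def horizontal_part_def inner_diff_right)
    then have hw: "horizontal_part z w = w" by (simp add: horizontal_part_def)
    have "fs_metric Y (cp_dproj z w) = fs_metric (cp_dproj z X) (cp_dproj z w)"
      using Y metric[OF w] cp_dproj_in_tangent_space[OF w] by simp
    then have "inner (horizontal_part z v) w = inner X w"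
      unfolding v(2) using fs_metric_eq v(1) X w hw hX by metis
    then have "inner w w = 0"
      by (subst (1) w_def) (simp add: inner_diff_left)
    then have "w = 0" by simp
    then have "v = X + inner (l2_cscale \<i> z) v *\<^sub>R l2_cscale \<i> z"
      by (simp add: w_def horizontal_part_def algebra_simps)
    then show "Y = cp_dproj z X"
      using cp_dproj_add_vertical(2)[OF X] v(2) by metis
  qed
qed

text \<open>Only coordinate \<open>n\<close> survives, so the coefficient comes out as a factor;
  this gives the replicator equation its growth rate.\<close>

lemma inner_diag_unit:
  "inner (l2_diag (l2_unit n) z) (l2_diag a z) = l2_nth a n * inner (l2_diag (l2_unit n) z) z"
proof transfer
  fix n a and z :: "nat \<Rightarrow> complex"
  have eq: "(\<Sum>k. inner ((if k = n then 1 else 0) *\<^sub>R z k) (g k)) = inner (z n) (g n)" for g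
    by (subst suminf_finite[of "{n}"]) auto
  show "(\<Sum>k. inner ((if k = n then 1 else 0) *\<^sub>R z k) (a k *\<^sub>R z k)) =
    a n * (\<Sum>k. inner ((if k = n then 1 else 0) *\<^sub>R z k) (z k))"
    unfolding eq by simp
qed

text \<open>The replicator equation for \<open>\<bar>z n\<bar>\<^sup>2\<close>. One factor 2 in the
  4 comes from differentiating the square, the other from the gradient.\<close>

lemma cp_H_unit_along_gradient:
  assumes "cp_has_velocity \<gamma> (cp_grad (cp_H a) (\<gamma> t)) t J" "t \<in> J" "t islimpt J"
  shows "((\<lambda>s. cp_H (l2_unit n) (\<gamma> s)) has_real_derivative
    4 * (l2_nth a n - cp_H a (\<gamma> t)) * cp_H (l2_unit n) (\<gamma> t)) (at t within J)"
proof -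
  obtain z v where z: "norm z = 1" "cp_proj z = \<gamma> t" "sphere_tangent z v"
    "cp_grad (cp_H a) (\<gamma> t) = cp_dproj z v"
    "((\<lambda>s. cp_H (l2_unit n) (\<gamma> s)) has_real_derivative
      2 * inner (l2_diag (l2_unit n) z) v) (at t within J)"
    using cp_H_along_velocity[OF assms] by metis
  define X where "X = 2 *\<^sub>R (l2_diag a z - inner (l2_diag a z) z *\<^sub>R z)"
  have "cp_dproj z X = cp_dproj z v" "sphere_tangent z X"
    using cp_grad_cp_H[OF z(1), of a] z(2,4) by (auto simp: X_def)
  then obtain q where q: "v = X + q *\<^sub>R l2_cscale \<i> z"
    using cp_dproj_same_base z(3) by metis
  have H: "cp_H b (\<gamma> t) = inner (l2_diag b z) z" for b
    using cp_H_proj[OF z(1)] z(2) by metis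
  have "2 * inner (l2_diag (l2_unit n) z) v = 4 * (l2_nth a n - cp_H a (\<gamma> t)) * cp_H (l2_unit n) (\<gamma> t)"
    unfolding q X_def H
    by (simp add: inner_add_right inner_diff_right inner_diag_i inner_diag_unit algebra_simps)
  with z(5) show ?thesis by simp
qed

section \<open>Simplex coordinates, vertices and the linear objective\<close>

lemma pos_sphere_proj:
  assumes "x \<in> pos_sphere"
  shows "cp_H (l2_unit n) (cp_proj (l2_of_real x)) = (l2_nth x n)\<^sup>2"
    and "l1_nth (inv_into pos_simplex sqrt_map x) n = (l2_nth x n)\<^sup>2"
    and "inv_into pos_simplex sqrt_map x \<in> pos_simplex"
proof -
  have "(norm (l2_of_real x))\<^sup>2 = (norm x)\<^sup>2"
    by (simp add: norm_l2_eq l2_of_real.rep_eq)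
  then have n: "norm (l2_of_real x) = 1"
    using assms by (simp add: pos_sphere_def)
  show "cp_H (l2_unit n) (cp_proj (l2_of_real x)) = (l2_nth x n)\<^sup>2"
    unfolding cp_H_proj[OF n] inner_diag
    by (subst suminf_finite[of "{n}"]) (auto simp: l2_unit.rep_eq l2_of_real.rep_eq)
  have im: "x \<in> sqrt_map ` pos_simplex"
    using bij_betw_sqrt_map assms by (simp add: bij_betw_def)
  show p: "inv_into pos_simplex sqrt_map x \<in> pos_simplex" by (rule inv_into_into[OF im])
  have "l2_nth x n = sqrt \<bar>l1_nth (inv_into pos_simplex sqrt_map x) n\<bar>"
    using f_inv_into_f[OF im] by (metis sqrt_map.rep_eq)
  then show "l1_nth (inv_into pos_simplex sqrt_map x) n = (l2_nth x n)\<^sup>2"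
    using p by (simp add: pos_simplex_def less_imp_le)
qed

lift_definition l1_unit :: "nat \<Rightarrow> l1" is "\<lambda>k n. if n = k then 1 else 0"
  by (rule summable_finite[of "{k}" for k]) auto

lemma l1_summable: "summable (l1_nth p)"
  using l1_nth[of p] summable_rabs_cancel by blast

text \<open>The mass missing at \<open>k\<close> equals the mass elsewhere, and each contributes
  \<open>1 - l1_nth p k\<close>. Convergence to a vertex is thus convergence of a single
  coordinate.\<close>

lemma dist_l1_unit:
  assumes "p \<in> closed_simplex"
  shows "dist p (l1_unit k) = 2 * (1 - l1_nth p k)"
proof -
  have p: "l1_nth p sums 1" "\<And>n. l1_nth p n \<ge> 0"
    using assms l1_summable[of p] by (auto simp: closed_simplex_def sums_iff)
  have le: "l1_nth p k \<le> 1"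
    using sum_le_suminf[OF l1_summable[of p], of "{k}"] p by (auto simp: sums_iff)
  \<comment> \<open>At \<open>k\<close> the absolute difference is
    \<open>1 - p k = p k + (1 - 2 * p k)\<close>, elsewhere it is \<open>p n\<close>.\<close>
  have "(\<lambda>n. l1_nth p n + (if n = k then 1 - 2 * l1_nth p k else 0)) sums (1 + (1 - 2 * l1_nth p k))"
    by (intro sums_add p(1) sums_single)
  also have "(\<lambda>n. l1_nth p n + (if n = k then 1 - 2 * l1_nth p k else 0)) =
      (\<lambda>n. \<bar>l1_nth (p - l1_unit k) n\<bar>)"
    using p(2) le by (auto simp: minus_l1.rep_eq l1_unit.rep_eq fun_eq_iff)
  finally show ?thesis
    by (simp add: dist_norm norm_l1.rep_eq sums_iff)
qed

text \<open>The objective is a weighted average of the coefficients, so it cannot exceed the largest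
  one, which the vertex attains.\<close>

lemma l1_unit_arg_max:
  assumes "\<And>n. l2_nth c n \<le> l2_nth c k"
  shows "is_arg_max (lp_objective c) (\<lambda>p. p \<in> closed_simplex) (l1_unit k)"
proof -
  have "(\<Sum>n. f n * l1_nth (l1_unit k) n) = f k" for f
    by (subst suminf_finite[of "{k}"]) (auto simp: l1_unit.rep_eq)
  from this[of "\<lambda>_. 1"] this[of "l2_nth c"]
  have "l1_unit k \<in> closed_simplex" "lp_objective c (l1_unit k) = l2_nth c k"
    by (auto simp: closed_simplex_def lp_objective_def l1_unit.rep_eq)
  moreover have "lp_objective c p \<le> l2_nth c k" if p: "p \<in> closed_simplex" for p
  proof -
    have nn: "l1_nth p n \<ge> 0" for n using p by (simp add: closed_simplex_def)
    have "summable (\<lambda>n. l2_nth c n * l1_nth p n)"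
      using l2_nth_le_norm[of c] nn
      by (intro summable_comparison_test'[OF summable_mult[OF l1_summable[of p], of "norm c"]])
        (auto simp: abs_mult intro!: mult_right_mono)
    then have "lp_objective c p \<le> (\<Sum>n. l2_nth c k * l1_nth p n)"
      unfolding lp_objective_def
      by (intro suminf_le summable_mult l1_summable) (auto intro!: mult_right_mono assms nn)
    also have "\<dots> = l2_nth c k"
      using p by (simp add: suminf_mult l1_summable closed_simplex_def)
    finally show ?thesis .
  qed
  ultimately show ?thesis by (auto simp: is_arg_max_def not_less)
qed

section \<open>Convergence of the flow to a vertex\<close>

text \<open>The factor \<open>H\<close> common to all components cancels in the ratios to \<open>p 0\<close>, which therefore decay
  exponentially, uniformly in the component.\<close>

lemma replicator_tendsto:
  fixes p :: "real \<Rightarrow> nat \<Rightarrow> real"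
  assumes deriv: "\<And>n t. t \<ge> 0 \<Longrightarrow>
      ((\<lambda>s. p s n) has_real_derivative 4 * (c n - H t) * p t n) (at t within {0..})"
    and pos: "\<And>n t. t \<ge> 0 \<Longrightarrow> p t n > 0" and sums: "\<And>t. t \<ge> 0 \<Longrightarrow> p t sums 1"
    and dec: "\<And>m n. m < n \<Longrightarrow> c n < c m"
  shows "((\<lambda>t. p t 0) \<longlongrightarrow> 1) at_top"
proof -
  have ratio: "p t n / p t 0 = p 0 n / p 0 0 * exp (4 * (c n - c 0) * t)" if t: "t \<ge> 0" for n t
  proof -
    \<comment> \<open>The quotient rule cancels \<open>H\<close> and leaves the rate
      \<open>4 * (c n - c 0)\<close>; the exponential compensates it, so \<open>g\<close> is
      constant.\<close>
    define g where "g s = p s n / p s 0 * exp (- (4 * (c n - c 0) * s))" for s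
    have "(g has_real_derivative 0) (at s within {0..})" if "s \<in> {0..}" for s
    proof -
      have s: "s \<ge> 0" using that by simp
      show ?thesis
        unfolding g_def using pos[OF s, of 0]
        by (auto intro!: derivative_eq_intros deriv[OF s] simp: field_simps)
    qed
    then have gt: "g t = g 0"
      using has_field_derivative_zero_constant[of "{0..}" g] t
      by (metis atLeast_iff convex_real_interval(1) order_refl)
    have "p t n / p t 0 = g t * exp (4 * (c n - c 0) * t)"
      by (simp add: g_def mult.assoc mult_exp_exp)
    also have "g t = p 0 n / p 0 0"
      unfolding gt by (simp add: g_def)
    finally show ?thesis .
  qed
  \<comment> \<open>The slowest decay among the ratios is that of index 1, since \<open>c 1\<close>
    is the largest of the remaining coefficients.\<close>
  define \<epsilon> where "\<epsilon> t = 1 / p 0 0 * exp (4 * (c 1 - c 0) * t)" for t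
  have bound: "1 / (1 + \<epsilon> t) \<le> p t 0 \<and> p t 0 \<le> 1" if t: "t \<ge> 0" for t
  proof -
    have le1: "p t 0 \<le> 1"
      using sum_le_suminf[of "p t" "{0}"] sums[OF t] pos[OF t] by (auto simp: sums_iff less_imp_le)
    have "(\<lambda>n. p t (Suc n)) sums (1 - p t 0)"
      using sums[OF t] by (simp add: sums_Suc_iff)
    moreover have "(\<lambda>n. p 0 (Suc n) * (p t 0 * \<epsilon> t)) sums ((1 - p 0 0) * (p t 0 * \<epsilon> t))"
      using sums[of 0] by (intro sums_mult2) (simp add: sums_Suc_iff)
    moreover have "p t (Suc n) \<le> p 0 (Suc n) * (p t 0 * \<epsilon> t)" for n
    proof -
      have "c (Suc n) \<le> c 1" using dec[of 1 "Suc n"] by (cases n) auto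
      then have "exp (4 * (c (Suc n) - c 0) * t) \<le> exp (4 * (c 1 - c 0) * t)"
        using t by (auto intro!: mult_right_mono)
      then have "p t (Suc n) / p t 0 \<le> p 0 (Suc n) / p 0 0 * exp (4 * (c 1 - c 0) * t)"
        unfolding ratio[OF t] using pos[of 0 "Suc n"] pos[of 0 0] by (intro mult_left_mono) auto
      then show ?thesis
        using pos[OF t, of 0] by (simp add: \<epsilon>_def field_simps)
    qed
    \<comment> \<open>Summing the termwise bounds over the indices \<open>Suc n\<close> compares the
      masses off index 0 at times \<open>t\<close> and 0.\<close>
    ultimately have "1 - p t 0 \<le> (1 - p 0 0) * (p t 0 * \<epsilon> t)"
      by (meson sums_le)
    also have "\<dots> \<le> 1 * (p t 0 * \<epsilon> t)"
      using pos[OF t, of 0] pos[of 0 0] by (intro mult_right_mono) (auto simp: \<epsilon>_def)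
    finally have "1 \<le> p t 0 * (1 + \<epsilon> t)" by (simp add: algebra_simps)
    moreover have "0 < 1 + \<epsilon> t" using pos[of 0 0] by (simp add: \<epsilon>_def add_pos_pos)
    ultimately show ?thesis using le1 by (simp add: field_simps)
  qed
  have "4 * (c 1 - c 0) < 0" using dec[of 0 1] by simp
  then have "((\<lambda>t. exp (4 * (c 1 - c 0) * t)) \<longlongrightarrow> 0) at_top"
    by (intro filterlim_compose[OF exp_at_bot] filterlim_tendsto_neg_mult_at_bot[OF tendsto_const]
        filterlim_ident)
  then have "((\<lambda>t. 1 / (1 + \<epsilon> t)) \<longlongrightarrow> 1 / (1 + 1 / p 0 0 * 0)) at_top"
    unfolding \<epsilon>_def by (intro tendsto_intros) auto
  then have lower: "((\<lambda>t. 1 / (1 + \<epsilon> t)) \<longlongrightarrow> 1) at_top" by simp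
  show ?thesis
    by (rule tendsto_sandwich[OF _ _ lower tendsto_const])
      (use bound in \<open>auto intro!: eventually_mono[OF eventually_ge_at_top[of 0]]\<close>)
qed

lemma grad_flow_line_tendsto:
  assumes x: "grad_flow_line_in_pos_sphere (cp_H c) x"
    and dec: "\<And>m n. m < n \<Longrightarrow> l2_nth c n < l2_nth c m"
  shows "((\<lambda>t. inv_into pos_simplex sqrt_map (x t)) \<longlongrightarrow> l1_unit 0) at_top"
proof -
  define \<gamma> where "\<gamma> = (\<lambda>t. cp_proj (l2_of_real (x t)))"
  define p where "p t n = (l2_nth (x t) n)\<^sup>2" for t n
  have pos: "x t \<in> pos_sphere" if "t \<ge> 0" for t
    using x that by (simp add: grad_flow_line_in_pos_sphere_def)
  have inv: "l1_nth (inv_into pos_simplex sqrt_map (x t)) = p t"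
    "inv_into pos_simplex sqrt_map (x t) \<in> closed_simplex" if "t \<ge> 0" for t
    using pos_sphere_proj(2,3)[OF pos[OF that]]
    by (auto simp: p_def fun_eq_iff pos_simplex_def closed_simplex_def less_imp_le)
  have lim: "((\<lambda>t. p t 0) \<longlongrightarrow> 1) at_top"
  proof (rule replicator_tendsto[OF _ _ _ dec])
    fix t :: real and n assume t: "t \<ge> 0"
    show "p t n > 0" using pos[OF t] unfolding p_def pos_sphere_def by (intro zero_less_power) simp
    show "p t sums 1"
      using inv[OF t] l1_summable[of "inv_into pos_simplex sqrt_map (x t)"]
      by (simp add: closed_simplex_def sums_iff)
    have V: "cp_has_velocity \<gamma> (cp_grad (cp_H c) (\<gamma> t)) t {0..}"
      using x t by (simp add: grad_flow_line_in_pos_sphere_def cp_integral_curve_def \<gamma>_def)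
    have "{0 :: real, 1} \<subseteq> {0..}" by simp
    \<comment> \<open>A connected set that is not a singleton has no isolated points; this includes
      the end point 0, where the derivative is one-sided.\<close>
    then have "\<nexists>a :: real. {0..} = {a}" by force
    then have "t islimpt {0..}"
      using t by (intro connected_imp_perfect convex_connected convex_real_interval) simp_all
    note d = cp_H_unit_along_gradient[OF V _ this, of n]
    have H: "cp_H (l2_unit n) (\<gamma> s) = p s n" if "s \<ge> 0" for s
      using pos_sphere_proj(1)[OF pos[OF that]] by (simp add: \<gamma>_def p_def)
    show "((\<lambda>s. p s n) has_real_derivative 4 * (l2_nth c n - cp_H c (\<gamma> t)) * p t n) (at t within {0..})"
      by (rule has_field_derivative_transform_within[OF d[unfolded H[OF t]] zero_less_one])
        (use t H in auto)
  qed
  have "((\<lambda>t. 2 * (1 - p t 0)) \<longlongrightarrow> 2 * (1 - 1)) at_top"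
    by (intro tendsto_intros lim)
  then have "((\<lambda>t. 2 * (1 - p t 0)) \<longlongrightarrow> 0) at_top" by simp
  then have "((\<lambda>t. dist (inv_into pos_simplex sqrt_map (x t)) (l1_unit 0)) \<longlongrightarrow> 0) at_top"
    by (rule Lim_transform_eventually)
      (auto intro!: eventually_mono[OF eventually_ge_at_top[of 0]] simp: dist_l1_unit inv)
  then show ?thesis by (rule tendsto_dist_iff[THEN iffD2])
qed

theorem theorem4p3:
  fixes c :: "real l2"
  shows
    "cp_smooth (cp_H c) \<and>
     (\<exists>F :: nat \<Rightarrow> cp_inf \<Rightarrow> real.
        (\<forall>n. cp_smooth (F n) \<and> cp_first_integral (cp_H c) (F n)) \<and>
        lin_indep_family UNIV F \<and>
        (\<forall>k n p. cp_poisson (F k) (F n) p = 0)) \<and>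
     (\<forall>n. cp_smooth (cp_H_comp c n) \<and> cp_first_integral (cp_H c) (cp_H_comp c n)) \<and>
     lin_indep_family {n. l2_nth c n \<noteq> 0} (cp_H_comp c) \<and>
     (\<forall>k n. k \<noteq> n \<longrightarrow> (\<forall>p. cp_poisson (cp_H_comp c k) (cp_H_comp c n) p = 0)) \<and>
     (\<forall>n p. cp_poisson (cp_H c) (cp_H_comp c n) p = 0) \<and>
     ((\<forall>m n. m < n \<longrightarrow> l2_nth c n < l2_nth c m) \<longrightarrow>
        (\<forall>x. grad_flow_line_in_pos_sphere (cp_H c) x \<longrightarrow>
           (\<exists>p_max. ((\<lambda>t. inv_into pos_simplex sqrt_map (x t)) \<longlongrightarrow> p_max) at_top \<and>
              is_arg_max (lp_objective c) (\<lambda>p. p \<in> closed_simplex) p_max)))"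
proof (intro conjI)
  show "\<exists>F :: nat \<Rightarrow> cp_inf \<Rightarrow> real.
        (\<forall>n. cp_smooth (F n) \<and> cp_first_integral (cp_H c) (F n)) \<and>
        lin_indep_family UNIV F \<and>
        (\<forall>k n p. cp_poisson (F k) (F n) p = 0)"
    \<comment> \<open>The squared moduli themselves serve as the infinite family: a component of
      \<open>cp_H c\<close> vanishes identically where its coefficient is zero.\<close>
    using lin_indep_family_cp_H_unit[of UNIV "\<lambda>_. 1"]
    by (intro exI[of _ "\<lambda>n. cp_H (l2_unit n)"])
      (simp add: cp_smooth_cp_H cp_first_integral_cp_H cp_poisson_cp_H)
  have comp: "cp_H_comp c = (\<lambda>n. cp_H (l2_nth c n *\<^sub>R l2_unit n))"
    by (simp add: fun_eq_iff cp_H_comp_eq)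
  show "lin_indep_family {n. l2_nth c n \<noteq> 0} (cp_H_comp c)"
    unfolding comp by (rule lin_indep_family_cp_H_unit) simp
  show "(\<forall>m n. m < n \<longrightarrow> l2_nth c n < l2_nth c m) \<longrightarrow>
        (\<forall>x. grad_flow_line_in_pos_sphere (cp_H c) x \<longrightarrow>
           (\<exists>p_max. ((\<lambda>t. inv_into pos_simplex sqrt_map (x t)) \<longlongrightarrow> p_max) at_top \<and>
              is_arg_max (lp_objective c) (\<lambda>p. p \<in> closed_simplex) p_max))"
  proof (intro impI allI)
    fix x
    assume dec: "\<forall>m n. m < n \<longrightarrow> l2_nth c n < l2_nth c m"
      and x: "grad_flow_line_in_pos_sphere (cp_H c) x"
    have "l2_nth c n \<le> l2_nth c 0" for n
      using dec by (cases n) (auto simp: less_imp_le)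
    then show "\<exists>p_max. ((\<lambda>t. inv_into pos_simplex sqrt_map (x t)) \<longlongrightarrow> p_max) at_top \<and>
        is_arg_max (lp_objective c) (\<lambda>p. p \<in> closed_simplex) p_max"
      using grad_flow_line_tendsto[OF x] l1_unit_arg_max[of c 0] dec by blast
  qed
qed (auto simp: cp_H_comp_eq cp_smooth_cp_H cp_first_integral_cp_H cp_poisson_cp_H)

end
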